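(* Let $\mathcal{A}$ be a finite set and let $\eta\in\mathcal{A}^{\mathbb{N}}$ be rationally almost periodic (RAP). Then there exists an $S$-invariant Borel probability measure $\nu$ on $X_\eta$ such that $\eta$ is generic for $\nu$ and the measure preserving system $(X_\eta,\nu,S)$ is ergodic and has rational discrete spectrum.
   Context: $\mathbb{N}=\{1,2,3,\dots\}$; $\mathcal{A}^{\mathbb{Z}}$ carries the product topology ($\mathcal{A}$ discrete) and $S:\mathcal{A}^{\mathbb{Z}}\to\mathcal{A}^{\mathbb{Z}}$ is the left shift, $(Sx)(n)=x(n+1)$. RAP: for $x,y\in\mathcal{A}^{\mathbb{N}}$ put $d_B(x,y)=\limsup_{N\to\infty}\frac1N|\{1\le n\le N:x(n)\neq y(n)\}|$. A sequence $x\in\mathcal{A}^{\mathbb{N}}$ is rationally almost periodic (RAP) if for every $\varepsilon>0$ there is a periodic $y\in\mathcal{A}^{\mathbb{N}}$ with $d_B(x,y)<\varepsilon$. Subshift: $X_\eta=\{x\in\mathcal{A}^{\mathbb{Z}}:\text{each finite word appearing in }x\text{ appears in }\eta\}$, where a word appearing in $x$ is a block $(x(n),x(n+1),\dots,x(m))$; $X_\eta$ is closed and $S$-invariant. Generic: $\eta\in\mathcal{A}^{\mathbb{N}}$ is generic for an $S$-invariant Borel probability measure $\nu$ on $\mathcal{A}^{\mathbb{Z}}$ if $\lim_{N\to\infty}\frac1N\sum_{n=0}^{N-1}f(S^n\tilde\eta)=\int f\,d\nu$ for all $f\in C(\mathcal{A}^{\mathbb{Z}})$, where $\tilde\eta\in\mathcal{A}^{\mathbb{Z}}$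 is any two-sided sequence with $\tilde\eta(n)=\eta(n)$ for all $n\in\mathbb{N}$ (this does not depend on the choice of $\tilde\eta$). Rational discrete spectrum: the linear span of the eigenfunctions is dense in $L^2(\nu)$ and all the corresponding eigenvalues are roots of unity. *)

theory Defs
  imports "HOL-Probability.Probability"
begin

text \<open>
  The alphabet is a type of sort \<open>{finite, discrete_topology}\<close>. Its two-sided sequences have type
  \<open>int \<Rightarrow> 'a\<close>, whose topology is the product topology and whose Borel sets are
  those of \<open>borel\<close>. A sequence indexed by the positive integers is
  represented by a function of type \<open>nat \<Rightarrow> 'a\<close>; its value at \<open>0\<close> is never used.
\<close>

definition left_shift :: "(int \<Rightarrow> 'a) \<Rightarrow> (int \<Rightarrow> 'a)" where
  "left_shift x = (\<lambda>n. x (n + 1))"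

subsection \<open>Rationally almost periodic sequences\<close>

definition besicovitch_dist :: "(nat \<Rightarrow> 'a) \<Rightarrow> (nat \<Rightarrow> 'a) \<Rightarrow> ereal" where
  "besicovitch_dist x y =
     limsup (\<lambda>N. ereal (real (card {n. 1 \<le> n \<and> n \<le> N \<and> x n \<noteq> y n}) / real N))"

definition periodic_seq :: "(nat \<Rightarrow> 'a) \<Rightarrow> bool" where
  "periodic_seq y \<longleftrightarrow> (\<exists>p\<ge>1. \<forall>n\<ge>1. y (n + p) = y n)"

definition rationally_almost_periodic :: "(nat \<Rightarrow> 'a) \<Rightarrow> bool" where
  "rationally_almost_periodic x \<longleftrightarrow>
     (\<forall>\<epsilon>>0. \<exists>y. periodic_seq y \<and> besicovitch_dist x y < ereal \<epsilon>)"

subsection \<open>The subshift and genericity\<close>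

definition words_Z :: "(int \<Rightarrow> 'a) \<Rightarrow> 'a list set" where
  "words_Z x = {map x [n..m] | n m. n \<le> m}"

definition words_N :: "(nat \<Rightarrow> 'a) \<Rightarrow> 'a list set" where
  "words_N \<eta> = {map \<eta> [n..<Suc m] | n m. 1 \<le> n \<and> n \<le> m}"

definition subshift :: "(nat \<Rightarrow> 'a) \<Rightarrow> (int \<Rightarrow> 'a) set" where
  "subshift \<eta> = {x. words_Z x \<subseteq> words_N \<eta>}"

definition generic_for :: "(nat \<Rightarrow> 'a::discrete_topology) \<Rightarrow> (int \<Rightarrow> 'a) measure \<Rightarrow> bool" where
  "generic_for \<eta> \<nu> \<longleftrightarrow>
     (\<forall>\<eta>'. (\<forall>n\<ge>1. \<eta>' (int n) = \<eta> n) \<longrightarrow>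
       (\<forall>f :: (int \<Rightarrow> 'a) \<Rightarrow> complex. continuous_on UNIV f \<longrightarrow>
          (\<lambda>N. (\<Sum>n<N. f ((left_shift ^^ n) \<eta>')) / of_nat N) \<longlonglongrightarrow> (LINT x|\<nu>. f x)))"

subsection \<open>Measure preserving systems\<close>

definition invariant_measure :: "'x measure \<Rightarrow> ('x \<Rightarrow> 'x) \<Rightarrow> bool" where
  "invariant_measure M T \<longleftrightarrow> T \<in> measurable M M \<and> distr M M T = M"

definition ergodic :: "'x measure \<Rightarrow> ('x \<Rightarrow> 'x) \<Rightarrow> bool" where
  "ergodic M T \<longleftrightarrow>
     (\<forall>B\<in>sets M. T -` B \<inter> space M = B \<longrightarrow> measure M B = 0 \<or> measure M B = 1)"

definition L2 :: "'x measure \<Rightarrow> ('x \<Rightarrow> complex) set" where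
  "L2 M = {f \<in> borel_measurable M. integrable M (\<lambda>x. (cmod (f x))\<^sup>2)}"

definition L2_norm :: "'x measure \<Rightarrow> ('x \<Rightarrow> complex) \<Rightarrow> real" where
  "L2_norm M f = sqrt (LINT x|M. (cmod (f x))\<^sup>2)"

text \<open>
  Elements of \<open>L2 M\<close> are functions rather than almost-everywhere classes, so that being nonzero
  and the eigenvalue equation are stated almost everywhere.
\<close>

definition eigenfunction :: "'x measure \<Rightarrow> ('x \<Rightarrow> 'x) \<Rightarrow> complex \<Rightarrow> ('x \<Rightarrow> complex) \<Rightarrow> bool" where
  "eigenfunction M T c f \<longleftrightarrow>
     f \<in> L2 M \<and> \<not> (AE x in M. f x = 0) \<and> (AE x in M. f (T x) = c * f x)"

definition rational_discrete_spectrum :: "'x measure \<Rightarrow> ('x \<Rightarrow> 'x) \<Rightarrow> bool" where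
  "rational_discrete_spectrum M T \<longleftrightarrow>
     (\<forall>g\<in>L2 M. \<forall>\<epsilon>>0. \<exists>F a. finite F \<and> (\<forall>f\<in>F. \<exists>c. eigenfunction M T c f) \<and>
        L2_norm M (\<lambda>x. g x - (\<Sum>f\<in>F. a f * f x)) < \<epsilon>) \<and>
     (\<forall>c f. eigenfunction M T c f \<longrightarrow> (\<exists>q\<ge>1::nat. c ^ q = 1))"

end

theory Submission
  imports Defs
begin

text \<open>
  Write \<open>S\<close> for the left shift and extend \<open>\<eta>\<close> to a two-sided sequence \<open>z\<close>. A cylinder set \<open>A\<close> is a
  set of sequences decided by finitely many coordinates. If \<open>y\<close> is periodic and close to \<open>\<eta>\<close> in
  density, then for most \<open>n\<close> the sequences \<open>S^n z\<close> and \<open>S^n y\<close> agree on the window of \<open>A\<close>. Hence the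
  sequence of truth values \<open>S^n z \<in> A\<close> is itself a limit in density of periodic sequences
  (\<open>rationally_almost_periodic_cylinder\<close>), and everything follows from this one fact, in four ways.

  Periodic sequences have averages, so every cylinder set has a frequency along the orbit of \<open>z\<close>. The
  space of sequences over a finite alphabet is compact, so a decreasing sequence of cylinder sets
  with empty intersection is eventually empty, and Caratheodory's theorem extends the frequencies to
  a Borel probability measure (\<open>frequency_measure_exists\<close>). Continuous functions are uniform limits of
  functions of finitely many coordinates, which gives genericity (\<open>continuous_average\<close>); a word that
  does not occur in \<open>\<eta>\<close> has frequency zero, so the measure lives on the subshift (\<open>AE_subshift\<close>).

  If \<open>p\<close> is the period of \<open>y\<close>, then \<open>z(n + p m)\<close> and \<open>z(n)\<close> agree for most \<open>n\<close>, uniformly in \<open>m\<close>.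
  Measured by the frequencies, this says that every cylinder set \<open>B\<close> is nearly invariant under all
  powers of \<open>S^p\<close> at once. The sets with such almost periods form a \<open>\<sigma>\<close>-algebra, so all measurable
  sets have them (\<open>almost_periodic_set_sigma_sets\<close>).

  For a set \<open>B\<close> with almost period \<open>p\<close>, the averages of the indicator of \<open>B\<close> along \<open>S^p\<close> stay close
  to the indicator, and they are Cauchy in \<open>L^1\<close> because the indicator is nearly periodic. Their limit
  is invariant under \<open>S^p\<close> (\<open>almost_periodic_set_invariant_approximation\<close>), and an \<open>S^p\<close>-invariant
  function is the sum of its \<open>p\<close> Fourier components for the action of the cyclic group of order \<open>p\<close>,
  each of which is an eigenfunction with a \<open>p\<close>-th root of unity as eigenvalue
  (\<open>rationally_approximable_periodic\<close>). So eigenfunctions with rational eigenvalues span a dense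
  subspace. An eigenfunction with any other eigenvalue would be orthogonal to all of them, hence
  zero (\<open>eigenvalue_rational\<close>).

  Finally, averages of a periodic sequence over long windows are nearly equal to its mean wherever
  the window starts. So the averages of the indicator of a cylinder set converge to a constant in
  \<open>L^1\<close>. An invariant set is then independent of every cylinder set, hence of itself, and has measure
  \<open>0\<close> or \<open>1\<close> (\<open>ergodic_if_averages_converge\<close>).
\<close>

section \<open>Averages of periodic sequences\<close>

lemma sum_period_shift:
  fixes u :: "nat \<Rightarrow> real"
  assumes "\<And>n. u (n + p) = u n"
  shows "(\<Sum>m<p. u (n + m)) = (\<Sum>m<p. u m)"
proof (induction n)
  case (Suc n)
  have "(\<Sum>m<p. u (Suc n + m)) + u n = (\<Sum>m<Suc p. u (n + m))"
    by (subst sum.lessThan_Suc_shift) simp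
  also have "\<dots> = (\<Sum>m<p. u (n + m)) + u n"
    using assms by simp
  finally show ?case
    using Suc by simp
qed simp

text \<open>
  The period contributes its mean to the average exactly, so only an incomplete period at the end
  of the window, of total weight at most \<open>p\<close>, causes an error. The bound does not depend on where
  the window starts; ergodicity will rest on this uniformity.
\<close>

lemma periodic_sum_mean:
  fixes u :: "nat \<Rightarrow> real"
  assumes "p \<ge> 1" and per: "\<And>n. u (n + p) = u n" and bd: "\<And>n. 0 \<le> u n \<and> u n \<le> 1"
  shows "\<bar>(\<Sum>m<N. u (n + m)) - real N * ((\<Sum>m<p. u m) / real p)\<bar> \<le> real p"
proof (induction N arbitrary: n rule: less_induct)
  case (less N)
  define c where "c = (\<Sum>m<p. u m) / real p"
  have c: "(\<Sum>m<p. u m) = real p * c"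
    using \<open>p \<ge> 1\<close> by (simp add: c_def)
  have "0 \<le> (\<Sum>m<p. u m)" "(\<Sum>m<p. u m) \<le> real p"
    using bd sum_bounded_above[of "{..<p}" u 1] by (auto intro: sum_nonneg)
  then have c01: "0 \<le> c" "c \<le> 1"
    using \<open>p \<ge> 1\<close> by (auto simp: c_def)
  have "\<bar>(\<Sum>m<N. u (n + m)) - real N * c\<bar> \<le> real p"
  proof (cases "N < p")
    case True
    have "0 \<le> (\<Sum>m<N. u (n + m))" "(\<Sum>m<N. u (n + m)) \<le> real N"
      using bd sum_bounded_above[of "{..<N}" "\<lambda>m. u (n + m)" 1] by (auto intro: sum_nonneg)
    moreover have "0 \<le> real N * c" "real N * c \<le> real N"
      using c01 by (auto intro: mult_left_le)
    ultimately show ?thesis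
      using True by linarith
  next
    case False
    then obtain K where N: "N = p + K"
      using le_Suc_ex by (metis not_less)
    have split: "(\<Sum>m<p + K. u (n + m)) = (\<Sum>m<p. u (n + m)) + (\<Sum>m<K. u ((n + p) + m))"
      by (induction K) (simp_all add: ac_simps)
    have "\<bar>(\<Sum>m<K. u ((n + p) + m)) - real K * c\<bar> \<le> real p"
      unfolding c_def using less[of K "n + p"] N \<open>p \<ge> 1\<close> by simp
    then show ?thesis
      unfolding N split sum_period_shift[of u p n, OF per] c by (simp add: algebra_simps)
  qed
  then show ?case
    by (simp add: c_def)
qed

section \<open>Measure preserving systems\<close>

locale measure_preserving_system = prob_space M for M :: "'x measure" +
  fixes T :: "'x \<Rightarrow> 'x"
  assumes T_measurable [measurable]: "T \<in> measurable M M"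
    and distr_T: "distr M M T = M"
begin

lemma funpow_measurable [measurable]: "(T ^^ n) \<in> measurable M M"
  by (induction n) auto

lemma distr_funpow: "distr M M (T ^^ n) = M"
proof (induction n)
  case (Suc n)
  have "distr M M (T ^^ Suc n) = distr (distr M M (T ^^ n)) M T"
    by (subst distr_distr) (auto simp: comp_def)
  then show ?case
    unfolding Suc distr_T .
qed (simp add: distr_id[unfolded id_def])

lemma funpow_space: "x \<in> space M \<Longrightarrow> (T ^^ n) x \<in> space M"
  using measurable_space[OF funpow_measurable] .

lemma integral_funpow:
  fixes f :: "'x \<Rightarrow> 'b :: {banach, second_countable_topology}"
  assumes [measurable]: "f \<in> borel_measurable M"
  shows "(LINT x|M. f ((T ^^ n) x)) = (LINT x|M. f x)"
  using integral_distr[of "T ^^ n" M M f] by (simp add: distr_funpow)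

lemma integrable_funpow:
  fixes f :: "'x \<Rightarrow> 'b :: {banach, second_countable_topology}"
  assumes "integrable M f"
  shows "integrable M (\<lambda>x. f ((T ^^ n) x))"
  using assms integrable_distr[of "T ^^ n" M M f] by (simp add: distr_funpow)

lemma integrable_bdd:
  fixes f :: "'x \<Rightarrow> 'b :: {banach, second_countable_topology}"
  assumes "f \<in> borel_measurable M" "\<And>x. x \<in> space M \<Longrightarrow> norm (f x) \<le> K"
  shows "integrable M f"
  by (rule integrable_const_bound[of _ K]) (use assms in auto)

lemma integrable_indicator_diff:
  assumes [measurable]: "B \<in> sets M" "C \<in> sets M"
  shows "integrable M (\<lambda>x. \<bar>indicat_real B ((T ^^ m) x) - indicat_real C ((T ^^ n) x)\<bar>)"
  by (rule integrable_bdd[of _ 1]) (auto simp: indicator_def)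

lemmas integrable_indicator_diffs = integrable_indicator_diff
  integrable_indicator_diff[where n = 0, simplified] integrable_indicator_diff[where m = 0, simplified]
  integrable_indicator_diff[where m = 0 and n = 0, simplified]

subsection \<open>Sets with rational almost periods\<close>

text \<open>
  The bound is uniform in \<open>m\<close>: one \<open>p\<close> serves all its multiples. This makes almost periods of two
  sets combine (their product works for both), and it survives averaging over \<open>m\<close>.
\<close>

definition almost_periodic_set :: "'x set \<Rightarrow> bool" where
  "almost_periodic_set B \<longleftrightarrow> B \<in> sets M \<and>
     (\<forall>\<epsilon>>0. \<exists>p\<ge>1. \<forall>m. (LINT x|M. \<bar>indicat_real B ((T ^^ (p * m)) x) - indicat_real B x\<bar>) \<le> \<epsilon>)"

lemma almost_periodic_setE:
  assumes "almost_periodic_set B" "\<epsilon> > 0"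
  obtains p where "p \<ge> 1"
    "\<And>m. (LINT x|M. \<bar>indicat_real B ((T ^^ (p * m)) x) - indicat_real B x\<bar>) \<le> \<epsilon>"
  using assms unfolding almost_periodic_set_def by blast

lemma almost_periodic_set_Un:
  assumes A: "almost_periodic_set A" and B: "almost_periodic_set B"
  shows "almost_periodic_set (A \<union> B)"
  unfolding almost_periodic_set_def
proof (intro conjI allI impI)
  have [measurable]: "A \<in> sets M" "B \<in> sets M"
    using A B by (auto simp: almost_periodic_set_def)
  show "A \<union> B \<in> sets M"
    by measurable
  fix \<epsilon> :: real assume "\<epsilon> > 0"
  then have e: "\<epsilon> / 2 > 0" by simp
  obtain p where p: "p \<ge> 1"
    "\<And>m. (LINT x|M. \<bar>indicat_real A ((T ^^ (p * m)) x) - indicat_real A x\<bar>) \<le> \<epsilon> / 2"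
    by (rule almost_periodic_setE[OF A e]) blast
  obtain q where q: "q \<ge> 1"
    "\<And>m. (LINT x|M. \<bar>indicat_real B ((T ^^ (q * m)) x) - indicat_real B x\<bar>) \<le> \<epsilon> / 2"
    by (rule almost_periodic_setE[OF B e]) blast
  have "(LINT x|M. \<bar>indicat_real (A \<union> B) ((T ^^ (p * q * m)) x) - indicat_real (A \<union> B) x\<bar>) \<le> \<epsilon>"
    for m
  proof -
    have "(LINT x|M. \<bar>indicat_real (A \<union> B) ((T ^^ (p * q * m)) x) - indicat_real (A \<union> B) x\<bar>)
      \<le> (LINT x|M. \<bar>indicat_real A ((T ^^ (p * q * m)) x) - indicat_real A x\<bar>
                 + \<bar>indicat_real B ((T ^^ (p * q * m)) x) - indicat_real B x\<bar>)"
      by (intro integral_mono Bochner_Integration.integrable_add integrable_indicator_diffs)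
        (auto split: split_indicator)
    also have "\<dots> = (LINT x|M. \<bar>indicat_real A ((T ^^ (p * (q * m))) x) - indicat_real A x\<bar>)
       + (LINT x|M. \<bar>indicat_real B ((T ^^ (q * (p * m))) x) - indicat_real B x\<bar>)"
      by (subst Bochner_Integration.integral_add)
        (auto simp: ac_simps intro: integrable_indicator_diffs)
    also have "\<dots> \<le> \<epsilon>"
      using p(2)[of "q * m"] q(2)[of "p * m"] by simp
    finally show ?thesis .
  qed
  then show "\<exists>r\<ge>1. \<forall>m. (LINT x|M. \<bar>indicat_real (A \<union> B) ((T ^^ (r * m)) x)
      - indicat_real (A \<union> B) x\<bar>) \<le> \<epsilon>"
    using p(1) q(1) by (intro exI[of _ "p * q"]) (auto simp: Suc_le_eq)
qed

lemma almost_periodic_set_empty: "almost_periodic_set {}"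
  by (auto simp: almost_periodic_set_def)

lemma almost_periodic_set_limit:
  assumes [measurable]: "B \<in> sets M"
    and approx: "\<And>\<epsilon>. \<epsilon> > 0 \<Longrightarrow>
      \<exists>C. almost_periodic_set C \<and> (LINT x|M. \<bar>indicat_real C x - indicat_real B x\<bar>) \<le> \<epsilon>"
  shows "almost_periodic_set B"
  unfolding almost_periodic_set_def
proof (intro conjI allI impI)
  fix \<epsilon> :: real assume "\<epsilon> > 0"
  then have e: "\<epsilon> / 3 > 0" by simp
  obtain C where C: "almost_periodic_set C"
    and CB: "(LINT x|M. \<bar>indicat_real C x - indicat_real B x\<bar>) \<le> \<epsilon> / 3"
    using approx[OF e] by blast
  have [measurable]: "C \<in> sets M"
    using C by (simp add: almost_periodic_set_def)
  obtain p where p: "p \<ge> 1"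
    "\<And>m. (LINT x|M. \<bar>indicat_real C ((T ^^ (p * m)) x) - indicat_real C x\<bar>) \<le> \<epsilon> / 3"
    by (rule almost_periodic_setE[OF C e]) blast
  have "(LINT x|M. \<bar>indicat_real B ((T ^^ (p * m)) x) - indicat_real B x\<bar>) \<le> \<epsilon>" for m
  proof -
    let ?d = "\<lambda>x. \<bar>indicat_real C x - indicat_real B x\<bar>"
    have [simp]: "integrable M (\<lambda>x. ?d ((T ^^ (p * m)) x))"
      by (intro integrable_indicator_diffs) auto
    have "(LINT x|M. \<bar>indicat_real B ((T ^^ (p * m)) x) - indicat_real B x\<bar>)
      \<le> (LINT x|M. ?d ((T ^^ (p * m)) x)
          + (\<bar>indicat_real C ((T ^^ (p * m)) x) - indicat_real C x\<bar> + ?d x))"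
      by (intro integral_mono Bochner_Integration.integrable_add integrable_indicator_diffs)
        (auto split: split_indicator)
    also have "\<dots> = (LINT x|M. ?d ((T ^^ (p * m)) x))
          + ((LINT x|M. \<bar>indicat_real C ((T ^^ (p * m)) x) - indicat_real C x\<bar>) + (LINT x|M. ?d x))"
      by (simp add: integrable_indicator_diffs)
    also have "\<dots> \<le> \<epsilon> / 3 + (\<epsilon> / 3 + \<epsilon> / 3)"
      using CB p(2)[of m] by (subst integral_funpow) auto
    finally show ?thesis by simp
  qed
  then show "\<exists>p\<ge>1. \<forall>m. (LINT x|M. \<bar>indicat_real B ((T ^^ (p * m)) x) - indicat_real B x\<bar>) \<le> \<epsilon>"
    using p(1) by blast
qed fact

lemma almost_periodic_set_compl:
  assumes "almost_periodic_set B"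
  shows "almost_periodic_set (space M - B)"
proof -
  have "(LINT x|M. \<bar>indicat_real (space M - B) ((T ^^ n) x) - indicat_real (space M - B) x\<bar>)
      = (LINT x|M. \<bar>indicat_real B ((T ^^ n) x) - indicat_real B x\<bar>)" for n
    by (intro Bochner_Integration.integral_cong) (auto simp: indicator_def funpow_space)
  then show ?thesis
    using assms by (auto simp: almost_periodic_set_def)
qed

lemma almost_periodic_set_UN:
  assumes disj: "disjoint_family B" and B: "\<And>i::nat. almost_periodic_set (B i)"
  shows "almost_periodic_set (\<Union>i. B i)"
proof (rule almost_periodic_set_limit)
  have [measurable]: "B i \<in> sets M" for i
    using B by (simp add: almost_periodic_set_def)
  show "(\<Union>i. B i) \<in> sets M" by measurable
  fix \<epsilon> :: real assume "\<epsilon> > 0"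
  have fin: "almost_periodic_set (\<Union>i<k. B i)" for k
  proof (induction k)
    case (Suc k)
    then show ?case
      using almost_periodic_set_Un[OF Suc B[of k]] by (simp add: lessThan_Suc Un_commute)
  qed (simp add: almost_periodic_set_empty)
  have "(\<lambda>k. measure M (\<Union>i<k. B i)) \<longlonglongrightarrow> measure M (\<Union>k. \<Union>i<k. B i)"
    by (intro finite_Lim_measure_incseq) (auto intro!: incseq_SucI simp: lessThan_Suc)
  also have "(\<Union>k. \<Union>i<k. B i) = (\<Union>i. B i)"
    by (auto intro: lessI)
  finally have "eventually (\<lambda>k. measure M (\<Union>i. B i) - \<epsilon> < measure M (\<Union>i<k. B i)) sequentially"
    using \<open>\<epsilon> > 0\<close> by (intro order_tendstoD) auto
  then obtain k where k: "measure M (\<Union>i. B i) - \<epsilon> < measure M (\<Union>i<k. B i)"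
    by (auto simp: eventually_sequentially)
  have "(LINT x|M. \<bar>indicat_real (\<Union>i<k. B i) x - indicat_real (\<Union>i. B i) x\<bar>)
      = (LINT x|M. indicat_real (\<Union>i. B i) x - indicat_real (\<Union>i<k. B i) x)"
    by (intro Bochner_Integration.integral_cong) (auto simp: indicator_def)
  also have "\<dots> = measure M (\<Union>i. B i) - measure M (\<Union>i<k. B i)"
    by (subst Bochner_Integration.integral_diff) (auto simp: less_top[symmetric] sets.sets_into_space Int_absorb2)
  also have "\<dots> \<le> \<epsilon>"
    using k by simp
  finally show "\<exists>C. almost_periodic_set C \<and>
      (LINT x|M. \<bar>indicat_real C x - indicat_real (\<Union>i. B i) x\<bar>) \<le> \<epsilon>"
    using fin by blast
qed

text \<open>
  Closure under complements is exact, closure under finite unions holds because almost periods can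
  be multiplied, and a countable disjoint union is approximated in measure by its finite parts.
\<close>

lemma almost_periodic_set_sigma_sets:
  assumes G: "Int_stable G" "G \<subseteq> Pow (space M)" "sets M = sigma_sets (space M) G"
    and ap: "\<And>A. A \<in> G \<Longrightarrow> almost_periodic_set A"
    and B: "B \<in> sets M"
  shows "almost_periodic_set B"
  using G(1,2) B[unfolded G(3)]
  by (induction rule: sigma_sets_induct_disjoint)
    (auto intro: ap almost_periodic_set_empty almost_periodic_set_compl almost_periodic_set_UN)

subsection \<open>Invariant approximations\<close>

definition ergodic_average :: "nat \<Rightarrow> 'x set \<Rightarrow> nat \<Rightarrow> 'x \<Rightarrow> real" where
  "ergodic_average q B N x = (\<Sum>m<N. indicat_real B ((T ^^ (q * m)) x)) / real N"

lemma ergodic_average_measurable [measurable]: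
  assumes [measurable]: "B \<in> sets M"
  shows "ergodic_average q B N \<in> borel_measurable M"
  unfolding ergodic_average_def[abs_def] divide_inverse
  by (intro borel_measurable_times borel_measurable_sum) measurable

lemma ergodic_average_bounds: "0 \<le> ergodic_average q B N x" "ergodic_average q B N x \<le> 1"
proof -
  have "(\<Sum>m<N. indicat_real B ((T ^^ (q * m)) x)) \<le> real N"
    using sum_bounded_above[of "{..<N}" "\<lambda>m. indicat_real B ((T ^^ (q * m)) x)" 1]
    by (auto simp: indicator_def)
  then show "ergodic_average q B N x \<le> 1"
    by (cases "N = 0") (auto simp: ergodic_average_def)
  show "0 \<le> ergodic_average q B N x"
    by (auto simp: ergodic_average_def intro!: divide_nonneg_nonneg sum_nonneg)
qed

lemma ergodic_average_integrable: "B \<in> sets M \<Longrightarrow> integrable M (ergodic_average q B N)"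
  using ergodic_average_bounds by (intro integrable_bdd[of _ 1]) auto

text \<open>
  The \<open>m\<close>-th term of the average differs in \<open>L^1\<close> by at most \<open>\<epsilon>\<close> from the term with index \<open>m mod r\<close>,
  because both indices differ by a multiple of the almost period \<open>r\<close>. The modified terms are
  periodic in \<open>m\<close> at every point, so their average is within \<open>r / N\<close> of the mean over one period.
\<close>

lemma ergodic_average_near_period_mean:
  assumes B: "B \<in> sets M" and r: "r \<ge> 1" and N: "N \<ge> 1"
    and ap: "\<And>m. (LINT x|M. \<bar>indicat_real B ((T ^^ (r * m)) x) - indicat_real B x\<bar>) \<le> \<epsilon>"
  shows "(LINT x|M. \<bar>ergodic_average q B N x - ergodic_average q B r x\<bar>) \<le> \<epsilon> + real r / real N"
proof -
  note [measurable] = B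
  let ?s = "\<lambda>m x. indicat_real B ((T ^^ (q * m)) x)"
  have d: "(LINT x|M. \<bar>?s m x - ?s (m mod r) x\<bar>) \<le> \<epsilon>" for m
  proof -
    let ?g = "\<lambda>x. \<bar>indicat_real B ((T ^^ (r * (q * (m div r)))) x) - indicat_real B x\<bar>"
    have eq: "q * m = r * (q * (m div r)) + q * (m mod r)"
      using mult_div_mod_eq[of r m] by (metis distrib_left mult.left_commute)
    have "\<bar>?s m x - ?s (m mod r) x\<bar> = ?g ((T ^^ (q * (m mod r))) x)" for x
      by (subst eq) (simp add: funpow_add)
    then have "(LINT x|M. \<bar>?s m x - ?s (m mod r) x\<bar>) = (LINT x|M. ?g ((T ^^ (q * (m mod r))) x))"
      by simp
    also have "\<dots> = (LINT x|M. ?g x)"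
      by (rule integral_funpow) measurable
    also have "\<dots> \<le> \<epsilon>"
      by (rule ap)
    finally show ?thesis .
  qed
  have pw: "\<bar>ergodic_average q B N x - ergodic_average q B r x\<bar>
    \<le> (\<Sum>m<N. \<bar>?s m x - ?s (m mod r) x\<bar>) / real N + real r / real N" for x
  proof -
    have "\<bar>(\<Sum>m<N. ?s (m mod r) x) - real N * ((\<Sum>m<r. ?s (m mod r) x) / real r)\<bar> \<le> real r"
    proof -
      have "\<bar>(\<Sum>m<N. ?s ((0 + m) mod r) x) - real N * ((\<Sum>m<r. ?s (m mod r) x) / real r)\<bar> \<le> real r"
        by (rule periodic_sum_mean[OF r]) (auto simp: indicator_def)
      then show ?thesis by simp
    qed
    moreover have "(\<Sum>m<r. ?s (m mod r) x) = (\<Sum>m<r. ?s m x)"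
      by (intro sum.cong) auto
    ultimately have "\<bar>(\<Sum>m<N. ?s (m mod r) x) - real N * ergodic_average q B r x\<bar> \<le> real r"
      by (simp add: ergodic_average_def)
    moreover have "\<bar>(\<Sum>m<N. ?s m x) - (\<Sum>m<N. ?s (m mod r) x)\<bar> \<le> (\<Sum>m<N. \<bar>?s m x - ?s (m mod r) x\<bar>)"
      unfolding sum_subtractf[symmetric] by (rule sum_abs)
    ultimately have *: "\<bar>(\<Sum>m<N. ?s m x) - real N * ergodic_average q B r x\<bar>
        \<le> (\<Sum>m<N. \<bar>?s m x - ?s (m mod r) x\<bar>) + real r"
      by linarith
    have "ergodic_average q B N x - ergodic_average q B r x
        = ((\<Sum>m<N. ?s m x) - real N * ergodic_average q B r x) / real N"
      unfolding ergodic_average_def[of q B N] using N by (simp add: field_simps)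
    then have "\<bar>ergodic_average q B N x - ergodic_average q B r x\<bar>
        = \<bar>(\<Sum>m<N. ?s m x) - real N * ergodic_average q B r x\<bar> / real N"
      by simp
    also have "\<dots> \<le> ((\<Sum>m<N. \<bar>?s m x - ?s (m mod r) x\<bar>) + real r) / real N"
      using * by (intro divide_right_mono) auto
    finally show ?thesis
      by (simp add: add_divide_distrib)
  qed
  have int: "integrable M (\<lambda>x. \<bar>?s m x - ?s (m mod r) x\<bar>)" for m
    by (intro integrable_indicator_diffs) measurable
  have "(LINT x|M. \<bar>ergodic_average q B N x - ergodic_average q B r x\<bar>)
    \<le> (LINT x|M. (\<Sum>m<N. \<bar>?s m x - ?s (m mod r) x\<bar>) / real N + real r / real N)"
    using int ergodic_average_integrable[OF B] pw
    by (intro integral_mono) (auto intro!: Bochner_Integration.integrable_add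
        Bochner_Integration.integrable_sum integrable_divide_zero)
  also have "\<dots> = (LINT x|M. (\<Sum>m<N. \<bar>?s m x - ?s (m mod r) x\<bar>) / real N) + real r / real N"
    using int by (subst Bochner_Integration.integral_add)
      (auto intro!: Bochner_Integration.integrable_sum integrable_divide_zero simp: prob_space)
  also have "(LINT x|M. (\<Sum>m<N. \<bar>?s m x - ?s (m mod r) x\<bar>) / real N)
     = (\<Sum>m<N. (LINT x|M. \<bar>?s m x - ?s (m mod r) x\<bar>)) / real N"
    using int by (simp add: Bochner_Integration.integral_sum)
  also have "\<dots> \<le> \<epsilon>"
  proof -
    have "(\<Sum>m<N. (LINT x|M. \<bar>?s m x - ?s (m mod r) x\<bar>)) \<le> (\<Sum>m<N. \<epsilon>)"
      by (intro sum_mono d)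
    then show ?thesis
      using N by (simp add: field_simps)
  qed
  finally show ?thesis by simp
qed

text \<open>
  All late averages are close to one and the same function, the average over an almost period. This
  replaces the mean ergodic theorem.
\<close>

lemma ergodic_average_Cauchy_L1:
  assumes B: "almost_periodic_set B" and "\<epsilon> > 0"
  shows "\<exists>N. \<forall>i\<ge>N. \<forall>j\<ge>N.
    (LINT x|M. norm (ergodic_average q B i x - ergodic_average q B j x)) < \<epsilon>"
proof -
  have [measurable]: "B \<in> sets M"
    using B by (simp add: almost_periodic_set_def)
  obtain r where r: "r \<ge> 1"
    "\<And>m. (LINT x|M. \<bar>indicat_real B ((T ^^ (r * m)) x) - indicat_real B x\<bar>) \<le> \<epsilon> / 5"
    by (rule almost_periodic_setE[OF B, of "\<epsilon> / 5"]) (use \<open>\<epsilon> > 0\<close> in auto)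
  \<comment> \<open>Past this index the incomplete period costs at most a fifth; two such distances of two fifths
    each stay strictly below the whole.\<close>
  obtain N0 where N0: "real r / (\<epsilon> / 5) < real N0"
    using reals_Archimedean2 by blast
  define N where "N = max 1 N0"
  have near: "(LINT x|M. \<bar>ergodic_average q B i x - ergodic_average q B r x\<bar>) \<le> 2 * \<epsilon> / 5"
    if "i \<ge> N" for i
  proof -
    have i: "i \<ge> 1" "real N0 \<le> real i"
      using that by (auto simp: N_def)
    have "real r / (\<epsilon> / 5) \<le> real i"
      using N0 i by linarith
    then have "real r \<le> \<epsilon> / 5 * real i"
      using \<open>\<epsilon> > 0\<close> by (simp add: field_simps)
    then have "real r / real i \<le> \<epsilon> / 5"
      using i by (simp add: field_simps)
    moreover have "(LINT x|M. \<bar>ergodic_average q B i x - ergodic_average q B r x\<bar>)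
        \<le> \<epsilon> / 5 + real r / real i"
      by (rule ergodic_average_near_period_mean[OF _ r(1) i(1) r(2)]) measurable
    ultimately show ?thesis
      by linarith
  qed
  have "(LINT x|M. norm (ergodic_average q B i x - ergodic_average q B j x)) < \<epsilon>"
    if "i \<ge> N" "j \<ge> N" for i j
  proof -
    have "(LINT x|M. norm (ergodic_average q B i x - ergodic_average q B j x))
      \<le> (LINT x|M. \<bar>ergodic_average q B i x - ergodic_average q B r x\<bar>
            + \<bar>ergodic_average q B j x - ergodic_average q B r x\<bar>)"
      by (intro integral_mono Bochner_Integration.integrable_add integrable_norm integrable_abs
          Bochner_Integration.integrable_diff ergodic_average_integrable) auto
    also have "\<dots> = (LINT x|M. \<bar>ergodic_average q B i x - ergodic_average q B r x\<bar>)
            + (LINT x|M. \<bar>ergodic_average q B j x - ergodic_average q B r x\<bar>)"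
      by (intro Bochner_Integration.integral_add integrable_abs
          Bochner_Integration.integrable_diff ergodic_average_integrable) auto
    also have "\<dots> < \<epsilon>"
      using near[OF that(1)] near[OF that(2)] \<open>\<epsilon> > 0\<close> by simp
    finally show ?thesis .
  qed
  then show ?thesis by blast
qed

lemma ergodic_average_shift:
  "\<bar>ergodic_average q B N ((T ^^ q) x) - ergodic_average q B N x\<bar> \<le> 1 / real N"
proof -
  let ?s = "\<lambda>m. indicat_real B ((T ^^ (q * m)) x)"
  have "(T ^^ (q * m)) ((T ^^ q) x) = (T ^^ (q * Suc m)) x" for m
    using funpow_add[of "q * m" q T] by (simp add: add.commute)
  then have "ergodic_average q B N ((T ^^ q) x) - ergodic_average q B N x
      = (\<Sum>m<N. ?s (Suc m) - ?s m) / real N"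
    unfolding ergodic_average_def diff_divide_distrib[symmetric] sum_subtractf[symmetric] by simp
  also have "\<dots> = (?s N - ?s 0) / real N"
    by (subst sum_lessThan_telescope) simp
  finally have "ergodic_average q B N ((T ^^ q) x) - ergodic_average q B N x
      = (?s N - ?s 0) / real N" .
  then show ?thesis
    by (auto simp: indicator_def)
qed

text \<open>
  The function \<open>g\<close> is the pointwise limit of a subsequence of the averages along \<open>T ^^ p\<close>, which exists
  almost everywhere by the Cauchy property in mean. Each average is within \<open>\<epsilon>\<close> of the indicator of
  \<open>B\<close> because each of its terms is, and dominated convergence passes this on to \<open>g\<close>.
\<close>

lemma almost_periodic_set_invariant_approximation:
  assumes B: "almost_periodic_set B" and "\<epsilon> > 0"
  obtains p g where "p \<ge> 1" "g \<in> borel_measurable M"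
    "\<And>x. x \<in> space M \<Longrightarrow> g ((T ^^ p) x) = g x" "AE x in M. 0 \<le> g x \<and> g x \<le> 1"
    "(LINT x|M. \<bar>g x - indicat_real B x\<bar>) \<le> \<epsilon>"
proof -
  have [measurable]: "B \<in> sets M"
    using B by (simp add: almost_periodic_set_def)
  obtain p where p: "p \<ge> 1"
    "\<And>m. (LINT x|M. \<bar>indicat_real B ((T ^^ (p * m)) x) - indicat_real B x\<bar>) \<le> \<epsilon>"
    by (rule almost_periodic_setE[OF B \<open>\<epsilon> > 0\<close>]) blast
  obtain r where r: "strict_mono r" and Cau: "AE x in M. Cauchy (\<lambda>i. ergodic_average p B (r i) x)"
    by (rule cauchy_L1_AE_cauchy_subseq[of M "ergodic_average p B"])
      (use ergodic_average_Cauchy_L1[OF B] ergodic_average_integrable in auto)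
  define g where "g x = lim (\<lambda>i. ergodic_average p B (r i) x)" for x
  have [measurable]: "g \<in> borel_measurable M"
    unfolding g_def[abs_def] by measurable
  have conv: "AE x in M. (\<lambda>i. ergodic_average p B (r i) x) \<longlonglongrightarrow> g x"
    using Cau unfolding g_def by eventually_elim (simp add: Cauchy_convergent_iff convergent_LIMSEQ_iff)
  show thesis
  proof (rule that[of p g])
    show "p \<ge> 1" "g \<in> borel_measurable M" by fact+
    \<comment> \<open>Averages along the orbits of \<open>x\<close> and of \<open>(T ^^ p) x\<close> have the same limits, if any. So the
      invariance also holds where \<open>lim\<close> returns its default value, and no null set is removed.\<close>
    show "g ((T ^^ p) x) = g x" if "x \<in> space M" for x
    proof -
      have "(\<lambda>N. ergodic_average p B N ((T ^^ p) x) - ergodic_average p B N x) \<longlonglongrightarrow> 0"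
        by (rule Lim_null_comparison[OF _ lim_1_over_n]) (use ergodic_average_shift in auto)
      then have d: "(\<lambda>i. ergodic_average p B (r i) ((T ^^ p) x) - ergodic_average p B (r i) x) \<longlonglongrightarrow> 0"
        by (rule LIMSEQ_subseq_LIMSEQ[OF _ r, unfolded o_def])
      have "(\<lambda>i. ergodic_average p B (r i) ((T ^^ p) x)) \<longlonglongrightarrow> l
          \<longleftrightarrow> (\<lambda>i. ergodic_average p B (r i) x) \<longlonglongrightarrow> l" for l
        by (rule Lim_transform_eq[OF d])
      then show ?thesis
        by (simp add: g_def lim_def)
    qed
    show "AE x in M. 0 \<le> g x \<and> g x \<le> 1"
      using conv by eventually_elim
        (auto intro: LIMSEQ_le_const LIMSEQ_le_const2 ergodic_average_bounds)
    have "(\<lambda>i. LINT x|M. \<bar>ergodic_average p B (r i) x - indicat_real B x\<bar>)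
        \<longlonglongrightarrow> (LINT x|M. \<bar>g x - indicat_real B x\<bar>)"
    proof (rule integral_dominated_convergence[where w = "\<lambda>_. 1"])
      show "AE x in M. (\<lambda>i. \<bar>ergodic_average p B (r i) x - indicat_real B x\<bar>)
          \<longlonglongrightarrow> \<bar>g x - indicat_real B x\<bar>"
        using conv by eventually_elim (intro tendsto_intros)
      show "AE x in M. norm \<bar>ergodic_average p B (r i) x - indicat_real B x\<bar> \<le> 1" for i
      proof (rule AE_I2)
        fix x
        show "norm \<bar>ergodic_average p B (r i) x - indicat_real B x\<bar> \<le> 1"
          using ergodic_average_bounds[of p B "r i" x] by (auto simp: indicator_def)
      qed
    qed auto
    moreover have "(LINT x|M. \<bar>ergodic_average p B N x - indicat_real B x\<bar>) \<le> \<epsilon>" if "N \<ge> 1" for N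
    proof -
      let ?d = "\<lambda>m x. \<bar>indicat_real B ((T ^^ (p * m)) x) - indicat_real B x\<bar>"
      have "\<bar>ergodic_average p B N x - indicat_real B x\<bar> \<le> (\<Sum>m<N. ?d m x) / real N" for x
      proof -
        have "ergodic_average p B N x - indicat_real B x
            = (\<Sum>m<N. indicat_real B ((T ^^ (p * m)) x) - indicat_real B x) / real N"
          using that by (simp add: ergodic_average_def sum_subtractf field_simps)
        then show ?thesis
          by (simp add: divide_right_mono)
      qed
      then have "(LINT x|M. \<bar>ergodic_average p B N x - indicat_real B x\<bar>)
          \<le> (LINT x|M. (\<Sum>m<N. ?d m x) / real N)"
        using ergodic_average_integrable by (intro integral_mono integrable_abs Bochner_Integration.integrable_diff)
          (auto intro!: Bochner_Integration.integrable_sum integrable_divide_zero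
            integrable_indicator_diffs simp: less_top[symmetric])
      also have "\<dots> = (\<Sum>m<N. LINT x|M. ?d m x) / real N"
        by (simp add: Bochner_Integration.integral_sum integrable_indicator_diffs)
      also have "\<dots> \<le> (\<Sum>m<N. \<epsilon>) / real N"
        by (intro divide_right_mono sum_mono p) auto
      finally show ?thesis
        using that by simp
    qed
    moreover have "r i \<ge> 1" if "i \<ge> 1" for i
      using strict_mono_imp_increasing[OF r, of i] that by linarith
    ultimately show "(LINT x|M. \<bar>g x - indicat_real B x\<bar>) \<le> \<epsilon>"
      by (intro LIMSEQ_le_const2) auto
  qed
qed

subsection \<open>Approximation by eigenfunctions with rational eigenvalues\<close>

lemma cmod_add_square_le: "(cmod (a + b))\<^sup>2 \<le> 2 * (cmod a)\<^sup>2 + 2 * (cmod b)\<^sup>2"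
proof -
  have "(cmod (a + b))\<^sup>2 \<le> (cmod a + cmod b)\<^sup>2"
    by (intro power_mono norm_triangle_ineq) auto
  also have "\<dots> \<le> 2 * (cmod a)\<^sup>2 + 2 * (cmod b)\<^sup>2"
    using sum_squares_bound[of "cmod a" "cmod b"] by (simp add: power2_sum)
  finally show ?thesis .
qed

lemma L2_measurable: "f \<in> L2 M \<Longrightarrow> f \<in> borel_measurable M"
  by (simp add: L2_def)

lemma L2_integrable: "f \<in> L2 M \<Longrightarrow> integrable M (\<lambda>x. (cmod (f x))\<^sup>2)"
  by (simp add: L2_def)

lemma L2_add:
  assumes "f \<in> L2 M" "g \<in> L2 M"
  shows "(\<lambda>x. f x + g x) \<in> L2 M"
proof -
  note [measurable] = assms[THEN L2_measurable]
  have "integrable M (\<lambda>x. (cmod (f x + g x))\<^sup>2)"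
    by (rule Bochner_Integration.integrable_bound[of _ "\<lambda>x. 2 * (cmod (f x))\<^sup>2 + 2 * (cmod (g x))\<^sup>2"])
      (use assms cmod_add_square_le in \<open>auto intro!: Bochner_Integration.integrable_add
        integrable_mult_right L2_integrable\<close>)
  then show ?thesis
    by (simp add: L2_def)
qed

lemma L2_scale: "f \<in> L2 M \<Longrightarrow> (\<lambda>x. c * f x) \<in> L2 M"
  by (auto simp: L2_def norm_mult power_mult_distrib)

lemma L2_diff: "f \<in> L2 M \<Longrightarrow> g \<in> L2 M \<Longrightarrow> (\<lambda>x. f x - g x) \<in> L2 M"
  using L2_add[of f "\<lambda>x. (-1) * g x"] L2_scale[of g "-1"] by simp

lemma L2_zero: "(\<lambda>x. 0) \<in> L2 M"
  by (simp add: L2_def)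

lemma L2_sum: "finite F \<Longrightarrow> (\<And>f. f \<in> F \<Longrightarrow> h f \<in> L2 M) \<Longrightarrow> (\<lambda>x. \<Sum>f\<in>F. h f x) \<in> L2 M"
  by (induction F rule: finite_induct) (auto intro: L2_zero L2_add)

lemma L2_AE_bounded:
  assumes "f \<in> borel_measurable M" "AE x in M. cmod (f x) \<le> K"
  shows "f \<in> L2 M"
proof -
  have "AE x in M. norm ((cmod (f x))\<^sup>2) \<le> K\<^sup>2"
    using assms(2) by eventually_elim (simp add: power_mono)
  then have "integrable M (\<lambda>x. (cmod (f x))\<^sup>2)"
    using assms(1) by (intro integrable_const_bound) auto
  with assms(1) show ?thesis
    by (simp add: L2_def)
qed

text \<open>
  Coefficients are attached to functions, as in the definition of discrete spectrum, so that a sum of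
  two elements merges the coefficients of the common eigenfunctions.
\<close>

definition rational_span :: "('x \<Rightarrow> complex) set" where
  "rational_span = {h. \<exists>F a. finite F \<and>
     (\<forall>f\<in>F. \<exists>c. eigenfunction M T c f \<and> (\<exists>q\<ge>1::nat. c ^ q = 1)) \<and>
     h = (\<lambda>x. \<Sum>f\<in>F. a f * f x)}"

lemma rational_spanI:
  assumes "finite F" "\<And>f. f \<in> F \<Longrightarrow> \<exists>c. eigenfunction M T c f \<and> (\<exists>q\<ge>1::nat. c ^ q = 1)"
  shows "(\<lambda>x. \<Sum>f\<in>F. a f * f x) \<in> rational_span"
  using assms unfolding rational_span_def by blast

lemma rational_spanE:
  assumes "h \<in> rational_span"
  obtains F a where "finite F"
    "\<And>f. f \<in> F \<Longrightarrow> \<exists>c. eigenfunction M T c f \<and> (\<exists>q\<ge>1::nat. c ^ q = 1)"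
    "h = (\<lambda>x. \<Sum>f\<in>F. a f * f x)"
  using assms unfolding rational_span_def by blast

lemma rational_span_zero: "(\<lambda>x. 0) \<in> rational_span"
  using rational_spanI[of "{}"] by simp

lemma rational_span_eigenfunction:
  assumes "eigenfunction M T c f" "c ^ q = 1" "q \<ge> 1"
  shows "f \<in> rational_span"
  using rational_spanI[of "{f}" "\<lambda>_. 1"] assms by auto

lemma rational_span_scale:
  assumes "h \<in> rational_span"
  shows "(\<lambda>x. c * h x) \<in> rational_span"
proof -
  obtain F a where F: "finite F"
    "\<And>f. f \<in> F \<Longrightarrow> \<exists>c. eigenfunction M T c f \<and> (\<exists>q\<ge>1::nat. c ^ q = 1)"
    and h: "h = (\<lambda>x. \<Sum>f\<in>F. a f * f x)"
    using assms by (rule rational_spanE) blast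
  show ?thesis
    using rational_spanI[OF F, of "\<lambda>f. c * a f"] by (simp add: h sum_distrib_left mult.assoc)
qed

lemma rational_span_add:
  assumes "h \<in> rational_span" "k \<in> rational_span"
  shows "(\<lambda>x. h x + k x) \<in> rational_span"
proof -
  obtain F a where F: "finite F"
    "\<And>f. f \<in> F \<Longrightarrow> \<exists>c. eigenfunction M T c f \<and> (\<exists>q\<ge>1::nat. c ^ q = 1)"
    and h: "h = (\<lambda>x. \<Sum>f\<in>F. a f * f x)"
    using assms(1) by (rule rational_spanE) blast
  obtain G b where G: "finite G"
    "\<And>f. f \<in> G \<Longrightarrow> \<exists>c. eigenfunction M T c f \<and> (\<exists>q\<ge>1::nat. c ^ q = 1)"
    and k: "k = (\<lambda>x. \<Sum>f\<in>G. b f * f x)"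
    using assms(2) by (rule rational_spanE) blast
  have "(\<Sum>f\<in>F. a f * f x) = (\<Sum>f\<in>F \<union> G. (if f \<in> F then a f else 0) * f x)"
    "(\<Sum>f\<in>G. b f * f x) = (\<Sum>f\<in>F \<union> G. (if f \<in> G then b f else 0) * f x)" for x
    using F(1) G(1) by (auto intro!: sum.mono_neutral_cong_left)
  then have "(\<lambda>x. h x + k x)
      = (\<lambda>x. \<Sum>f\<in>F \<union> G. ((if f \<in> F then a f else 0) + (if f \<in> G then b f else 0)) * f x)"
    by (simp add: h k sum.distrib[symmetric] distrib_right)
  then show ?thesis
    using rational_spanI[of "F \<union> G" "\<lambda>f. (if f \<in> F then a f else 0) + (if f \<in> G then b f else 0)"]
      F G by auto
qed

lemma rational_span_L2: "h \<in> rational_span \<Longrightarrow> h \<in> L2 M"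
  by (erule rational_spanE) (auto intro!: L2_sum L2_scale simp: eigenfunction_def)

text \<open>
  Distances are measured by the square of the \<open>L^2\<close> norm. Then the inequality
  \<open>cmod_add_square_le\<close> takes the place of the triangle inequality, and no square roots occur.
\<close>

definition rationally_approximable :: "('x \<Rightarrow> complex) \<Rightarrow> bool" where
  "rationally_approximable h \<longleftrightarrow> h \<in> L2 M \<and>
     (\<forall>\<epsilon>>0. \<exists>t\<in>rational_span. (LINT x|M. (cmod (h x - t x))\<^sup>2) < \<epsilon>)"

lemma rationally_approximableE:
  assumes "rationally_approximable h" "\<epsilon> > 0"
  obtains t where "t \<in> rational_span" "(LINT x|M. (cmod (h x - t x))\<^sup>2) < \<epsilon>"
  using assms by (auto simp: rationally_approximable_def)

lemma L2_square_integral_add_le: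
  assumes "f \<in> L2 M" "g \<in> L2 M"
  shows "(LINT x|M. (cmod (f x + g x))\<^sup>2)
    \<le> 2 * (LINT x|M. (cmod (f x))\<^sup>2) + 2 * (LINT x|M. (cmod (g x))\<^sup>2)"
proof -
  have "(LINT x|M. (cmod (f x + g x))\<^sup>2) \<le> (LINT x|M. 2 * (cmod (f x))\<^sup>2 + 2 * (cmod (g x))\<^sup>2)"
    using assms cmod_add_square_le
    by (intro integral_mono Bochner_Integration.integrable_add integrable_mult_right
        L2_integrable[OF L2_add]) (auto intro: L2_integrable)
  also have "\<dots> = 2 * (LINT x|M. (cmod (f x))\<^sup>2) + 2 * (LINT x|M. (cmod (g x))\<^sup>2)"
    using assms by (simp add: L2_integrable)
  finally show ?thesis .
qed

lemma rationally_approximable_add: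
  assumes h: "rationally_approximable h" and k: "rationally_approximable k"
  shows "rationally_approximable (\<lambda>x. h x + k x)"
  unfolding rationally_approximable_def
proof (intro conjI allI impI)
  have L: "h \<in> L2 M" "k \<in> L2 M"
    using h k by (auto simp: rationally_approximable_def)
  then show "(\<lambda>x. h x + k x) \<in> L2 M"
    by (rule L2_add)
  fix \<epsilon> :: real assume "\<epsilon> > 0"
  then have e: "\<epsilon> / 4 > 0" by simp
  obtain s where s: "s \<in> rational_span" "(LINT x|M. (cmod (h x - s x))\<^sup>2) < \<epsilon> / 4"
    using h e by (rule rationally_approximableE)
  obtain t where t: "t \<in> rational_span" "(LINT x|M. (cmod (k x - t x))\<^sup>2) < \<epsilon> / 4"
    using k e by (rule rationally_approximableE)
  have "(LINT x|M. (cmod ((h x - s x) + (k x - t x)))\<^sup>2) < \<epsilon>"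
    using L2_square_integral_add_le[OF L2_diff[OF L(1) rational_span_L2[OF s(1)]]
        L2_diff[OF L(2) rational_span_L2[OF t(1)]]] s(2) t(2) by linarith
  then have "(LINT x|M. (cmod ((h x + k x) - (s x + t x)))\<^sup>2) < \<epsilon>"
    by (simp add: algebra_simps)
  then show "\<exists>t\<in>rational_span. (LINT x|M. (cmod ((h x + k x) - t x))\<^sup>2) < \<epsilon>"
    by (rule bexI[OF _ rational_span_add[OF s(1) t(1)]])
qed

lemma rationally_approximable_scale:
  assumes h: "rationally_approximable h"
  shows "rationally_approximable (\<lambda>x. c * h x)"
  unfolding rationally_approximable_def
proof (intro conjI allI impI)
  show "(\<lambda>x. c * h x) \<in> L2 M"
    using h by (auto simp: rationally_approximable_def intro: L2_scale)
  fix \<epsilon> :: real assume "\<epsilon> > 0"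
  define K where "K = (cmod c)\<^sup>2 + 1"
  have K: "K > 0" "(cmod c)\<^sup>2 \<le> K"
    by (auto simp: K_def add_nonneg_pos)
  obtain t where t: "t \<in> rational_span" "(LINT x|M. (cmod (h x - t x))\<^sup>2) < \<epsilon> / K"
    by (rule rationally_approximableE[OF h, of "\<epsilon> / K"]) (use \<open>\<epsilon> > 0\<close> K in auto)
  have "(LINT x|M. (cmod (c * h x - c * t x))\<^sup>2) = (cmod c)\<^sup>2 * (LINT x|M. (cmod (h x - t x))\<^sup>2)"
    by (simp add: norm_mult power_mult_distrib flip: right_diff_distrib)
  also have "\<dots> \<le> K * (LINT x|M. (cmod (h x - t x))\<^sup>2)"
    using K by (intro mult_right_mono) auto
  also have "\<dots> < \<epsilon>"
    using t(2) K by (simp add: field_simps)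
  finally show "\<exists>t\<in>rational_span. (LINT x|M. (cmod (c * h x - t x))\<^sup>2) < \<epsilon>"
    by (rule bexI[OF _ rational_span_scale[OF t(1)]])
qed

lemma rationally_approximable_limit:
  assumes h: "h \<in> L2 M"
    and lim: "\<And>\<epsilon>. \<epsilon> > 0 \<Longrightarrow> \<exists>k. rationally_approximable k \<and> (LINT x|M. (cmod (h x - k x))\<^sup>2) < \<epsilon>"
  shows "rationally_approximable h"
  unfolding rationally_approximable_def
proof (intro conjI allI impI)
  fix \<epsilon> :: real assume "\<epsilon> > 0"
  then have e: "\<epsilon> / 4 > 0" by simp
  obtain k where k: "rationally_approximable k" "(LINT x|M. (cmod (h x - k x))\<^sup>2) < \<epsilon> / 4"
    using lim[OF e] by blast
  obtain t where t: "t \<in> rational_span" "(LINT x|M. (cmod (k x - t x))\<^sup>2) < \<epsilon> / 4"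
    using k(1) e by (rule rationally_approximableE)
  have kL: "k \<in> L2 M"
    using k(1) by (simp add: rationally_approximable_def)
  have "(LINT x|M. (cmod ((h x - k x) + (k x - t x)))\<^sup>2) < \<epsilon>"
    using L2_square_integral_add_le[OF L2_diff[OF h kL] L2_diff[OF kL rational_span_L2[OF t(1)]]]
      k(2) t(2) by linarith
  then show "\<exists>t\<in>rational_span. (LINT x|M. (cmod (h x - t x))\<^sup>2) < \<epsilon>"
    using t(1) by auto
qed fact

lemma rationally_approximable_span: "h \<in> rational_span \<Longrightarrow> rationally_approximable h"
  by (auto simp: rationally_approximable_def intro!: rational_span_L2 bexI[of _ h])

lemma rationally_approximable_sum:
  "finite F \<Longrightarrow> (\<And>f. f \<in> F \<Longrightarrow> rationally_approximable (h f)) \<Longrightarrow>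
    rationally_approximable (\<lambda>x. \<Sum>f\<in>F. h f x)"
  by (induction F rule: finite_induct)
    (auto intro: rationally_approximable_add rationally_approximable_span rational_span_zero)

lemma rationally_approximable_cong:
  assumes "rationally_approximable h" "\<And>x. x \<in> space M \<Longrightarrow> h x = k x"
  shows "rationally_approximable k"
proof -
  have 1: "k \<in> borel_measurable M \<longleftrightarrow> h \<in> borel_measurable M"
    using assms(2) by (intro measurable_cong) auto
  have 2: "integrable M (\<lambda>x. (cmod (k x))\<^sup>2) \<longleftrightarrow> integrable M (\<lambda>x. (cmod (h x))\<^sup>2)"
    using assms(2) by (intro Bochner_Integration.integrable_cong) auto
  have 3: "(LINT x|M. (cmod (k x - t x))\<^sup>2) = (LINT x|M. (cmod (h x - t x))\<^sup>2)" for t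
    using assms(2) by (intro Bochner_Integration.integral_cong) auto
  show ?thesis
    using assms(1) unfolding rationally_approximable_def L2_def mem_Collect_eq 1 2 3 .
qed

text \<open>
  The case distinction is needed because a function that vanishes almost everywhere satisfies the
  eigenvalue equation but is not an eigenfunction; it is approximated by the empty sum.
\<close>

lemma rationally_approximable_rational_eigenvalue:
  assumes f: "f \<in> L2 M" and eig: "\<And>x. x \<in> space M \<Longrightarrow> f (T x) = c * f x"
    and c: "c ^ q = 1" "q \<ge> 1"
  shows "rationally_approximable f"
proof (cases "AE x in M. f x = 0")
  case True
  have "(LINT x|M. (cmod (f x - 0))\<^sup>2) = (LINT x|M. 0)"
    using True f by (intro integral_cong_AE) (auto dest: L2_measurable)
  then show ?thesis
    using f unfolding rationally_approximable_def by (auto intro!: bexI[OF _ rational_span_zero])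
next
  case False
  then have "eigenfunction M T c f"
    using f eig by (auto simp: eigenfunction_def)
  then show ?thesis
    using c by (intro rationally_approximable_span rational_span_eigenfunction)
qed

text \<open>
  The transformation acts on \<open>g\<close> like the cyclic group of order \<open>p\<close>. With \<open>z j\<close> running through the
  \<open>p\<close>-th roots of unity, the function \<open>G j\<close> is the projection of \<open>g\<close>, up to the factor \<open>p\<close>, to the
  eigenspace of \<open>inverse (z j)\<close>. Summing over \<open>j\<close> recovers \<open>g\<close> since the sum of the \<open>i\<close>-th powers of
  the roots of unity vanishes for \<open>0 < i < p\<close>.
\<close>

lemma rationally_approximable_periodic:
  fixes g :: "'x \<Rightarrow> complex"
  assumes p: "p \<ge> 1" and g: "g \<in> L2 M" and per: "\<And>x. x \<in> space M \<Longrightarrow> g ((T ^^ p) x) = g x"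
  shows "rationally_approximable g"
proof -
  note [measurable] = L2_measurable[OF g]
  define z where "z j = exp (2 * of_real pi * \<i> * of_nat j / of_nat p)" for j :: nat
  define G where "G j x = (\<Sum>i<p. z j ^ i * g ((T ^^ i) x))" for j x
  have z_power: "z j ^ i = exp (2 * of_real pi * \<i> * of_nat (j * i) / of_nat p)" for i j
    by (simp add: z_def exp_of_nat_mult[symmetric] mult_ac)
  have z1: "z j ^ p = 1" and z0: "z j \<noteq> 0" for j
    using p complex_root_unity_eq_1[of p "j * p"] by (auto simp: z_power) (simp add: z_def)
  have approx: "rationally_approximable (G j)" for j
  proof (rule rationally_approximable_rational_eigenvalue[where c = "inverse (z j)" and q = p])
    have "(\<lambda>x. g ((T ^^ i) x)) \<in> L2 M" for i
      using integrable_funpow[OF L2_integrable[OF g]] by (simp add: L2_def)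
    then show "G j \<in> L2 M"
      unfolding G_def[abs_def] by (intro L2_sum L2_scale) auto
    fix x assume x: "x \<in> space M"
    \<comment> \<open>Multiplication by \<open>z j\<close> shifts the index of the sum by one; the term that leaves at the
      bottom and the one that enters at the top are both \<open>g x\<close>.\<close>
    have "z j * G j (T x) = (\<Sum>i<p. z j ^ Suc i * g ((T ^^ Suc i) x))"
      by (simp add: G_def sum_distrib_left mult.assoc funpow_swap1)
    also have "\<dots> + g x = (\<Sum>i<Suc p. z j ^ i * g ((T ^^ i) x))"
      by (subst sum.lessThan_Suc_shift) simp
    also have "\<dots> = G j x + g x"
      using per[OF x] z1[of j] by (simp add: G_def)
    finally show "G j (T x) = inverse (z j) * G j x"
      using z0[of j] by (simp add: field_simps)
  next
    show "inverse (z j) ^ p = 1" "p \<ge> 1"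
      using z1[of j] p by (auto simp: power_inverse)
  qed
  have zsum: "(\<Sum>j<p. z j ^ i) = (if i = 0 then of_nat p else 0)" if "i < p" for i
  proof (cases "i = 0")
    case False
    have "z i \<noteq> 1"
      using complex_root_unity_eq_1[OF p, of i] False that by (auto simp: z_def dest: dvd_imp_le)
    moreover have "(\<Sum>j<p. z j ^ i) = (\<Sum>j<p. z i ^ j)"
      unfolding z_power by (simp add: mult_ac)
    ultimately show ?thesis
      using False z1[of i] geometric_sum[of "z i" p] by simp
  qed simp
  have "(\<Sum>j<p. G j x) = of_nat p * g x" for x
  proof -
    have "(\<Sum>j<p. G j x) = (\<Sum>i<p. (\<Sum>j<p. z j ^ i) * g ((T ^^ i) x))"
      unfolding G_def sum_distrib_right by (rule sum.swap)
    also have "\<dots> = (\<Sum>i<p. (if i = 0 then of_nat p * g x else 0))"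
      by (intro sum.cong) (auto simp: zsum)
    finally show ?thesis
      using p by (simp add: sum.delta)
  qed
  then have "g = (\<lambda>x. (1 / of_nat p) * (\<Sum>j<p. G j x))"
    using p by auto
  then show ?thesis
    using rationally_approximable_scale[OF rationally_approximable_sum[of "{..<p}" G]] approx
    by (metis finite_lessThan)
qed

text \<open>
  The invariant approximation of the indicator is close in \<open>L^1\<close>, hence also in \<open>L^2\<close>: both functions
  take values between \<open>0\<close> and \<open>1\<close>, and the square of their difference is at most its modulus.
\<close>

lemma rationally_approximable_indicator:
  assumes B: "almost_periodic_set B"
  shows "rationally_approximable (indicator B)"
proof (rule rationally_approximable_limit)
  have [measurable]: "B \<in> sets M"
    using B by (simp add: almost_periodic_set_def)
  show "indicator B \<in> L2 M"
    by (rule L2_AE_bounded[of _ 1]) (auto simp: indicator_def)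
  fix \<epsilon> :: real assume "\<epsilon> > 0"
  obtain p g where p: "p \<ge> 1" and g [measurable]: "g \<in> borel_measurable M"
    and per: "\<And>x. x \<in> space M \<Longrightarrow> g ((T ^^ p) x) = g x"
    and g01: "AE x in M. 0 \<le> g x \<and> g x \<le> 1"
    and gB: "(LINT x|M. \<bar>g x - indicat_real B x\<bar>) \<le> \<epsilon> / 2"
    by (rule almost_periodic_set_invariant_approximation[OF B, of "\<epsilon> / 2"]) (use \<open>\<epsilon> > 0\<close> in auto)
  have "integrable M g"
    using g01 by (intro integrable_const_bound[of _ 1]) auto
  then have "integrable M (\<lambda>x. \<bar>g x - indicat_real B x\<bar>)"
    by (auto simp: less_top[symmetric])
  moreover have le: "AE x in M. (cmod (indicator B x - of_real (g x)))\<^sup>2 \<le> \<bar>g x - indicat_real B x\<bar>"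
    using g01
  proof eventually_elim
    case (elim x)
    have "(cmod (indicator B x - of_real (g x)))\<^sup>2 = \<bar>g x - indicat_real B x\<bar>\<^sup>2"
      by (cases "x \<in> B") (simp_all add: cmod_power2 power2_commute)
    also have "\<dots> \<le> \<bar>g x - indicat_real B x\<bar>"
      unfolding power2_eq_square using elim by (intro mult_left_le) (auto simp: indicator_def)
    finally show ?case .
  qed
  moreover have "integrable M (\<lambda>x. (cmod (indicator B x - of_real (g x)))\<^sup>2)"
    by (rule Bochner_Integration.integrable_bound[OF calculation(1)]) (use le in auto)
  ultimately have "(LINT x|M. (cmod (indicator B x - of_real (g x)))\<^sup>2) \<le> \<epsilon> / 2"
    using gB by (intro order_trans[OF integral_mono_AE gB]) auto
  then have "(LINT x|M. (cmod (indicator B x - of_real (g x)))\<^sup>2) < \<epsilon>"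
    using \<open>\<epsilon> > 0\<close> by simp
  moreover have "rationally_approximable (\<lambda>x. of_real (g x))"
    using g01 per by (intro rationally_approximable_periodic[OF p] L2_AE_bounded[of _ 1]) auto
  ultimately show "\<exists>k. rationally_approximable k \<and> (LINT x|M. (cmod (indicator B x - k x))\<^sup>2) < \<epsilon>"
    by blast
qed

lemma rationally_approximable_simple:
  assumes s: "simple_function M s" and ap: "\<forall>B\<in>sets M. almost_periodic_set B"
  shows "rationally_approximable s"
proof (rule rationally_approximable_cong)
  let ?B = "\<lambda>v. s -` {v} \<inter> space M"
  have fin: "finite (s ` space M)"
    using s by (rule simple_functionD)
  show "rationally_approximable (\<lambda>x. \<Sum>v\<in>s ` space M. v * indicator (?B v) x)"
    using simple_functionD(2)[OF s] by (intro rationally_approximable_sum[OF fin]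
        rationally_approximable_scale rationally_approximable_indicator ap[rule_format])
  fix x assume x: "x \<in> space M"
  have "(\<Sum>v\<in>s ` space M. v * indicator (?B v) x) = (\<Sum>v\<in>s ` space M. if v = s x then s x else 0)"
    using x by (intro sum.cong) (auto simp: indicator_def)
  then show "(\<Sum>v\<in>s ` space M. v * indicator (?B v) x) = s x"
    using fin x by simp
qed

text \<open>
  Simple functions are combinations of indicators, and they are dense: a pointwise approximation
  \<open>F i\<close> of \<open>h\<close> can be chosen with modulus at most twice that of \<open>h\<close>, so that \<open>9\<close> times the square of
  \<open>h\<close> dominates the squared differences.
\<close>

lemma rationally_approximable_L2:
  assumes h: "h \<in> L2 M" and ap: "\<forall>B\<in>sets M. almost_periodic_set B"
  shows "rationally_approximable h"
proof (rule rationally_approximable_limit[OF h])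
  note [measurable] = L2_measurable[OF h]
  obtain F where F: "\<And>i. simple_function M (F i)" "\<And>x. x \<in> space M \<Longrightarrow> (\<lambda>i. F i x) \<longlonglongrightarrow> h x"
    "\<And>i x. x \<in> space M \<Longrightarrow> dist (F i x) 0 \<le> 2 * dist (h x) 0"
    using borel_measurable_implies_sequence_metric[OF L2_measurable[OF h], of 0] by blast
  have [measurable]: "F i \<in> borel_measurable M" for i
    using F(1) by (rule borel_measurable_simple_function)
  have "(\<lambda>i. LINT x|M. (cmod (h x - F i x))\<^sup>2) \<longlonglongrightarrow> (LINT x|M. 0)"
  proof (rule integral_dominated_convergence[where w = "\<lambda>x. 9 * (cmod (h x))\<^sup>2"])
    show "integrable M (\<lambda>x. 9 * (cmod (h x))\<^sup>2)"
      using h by (simp add: L2_integrable)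
    show "AE x in M. (\<lambda>i. (cmod (h x - F i x))\<^sup>2) \<longlonglongrightarrow> 0"
    proof (rule AE_I2)
      fix x assume "x \<in> space M"
      then have "(\<lambda>i. (cmod (h x - F i x))\<^sup>2) \<longlonglongrightarrow> (cmod (h x - h x))\<^sup>2"
        by (intro tendsto_intros F)
      then show "(\<lambda>i. (cmod (h x - F i x))\<^sup>2) \<longlonglongrightarrow> 0" by simp
    qed
    show "AE x in M. norm ((cmod (h x - F i x))\<^sup>2) \<le> 9 * (cmod (h x))\<^sup>2" for i
    proof (rule AE_I2)
      fix x assume x: "x \<in> space M"
      have "cmod (h x - F i x) \<le> 3 * cmod (h x)"
        using norm_triangle_ineq4[of "h x" "F i x"] F(3)[OF x, of i] by simp
      then have "(cmod (h x - F i x))\<^sup>2 \<le> (3 * cmod (h x))\<^sup>2"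
        by (intro power_mono) auto
      then show "norm ((cmod (h x - F i x))\<^sup>2) \<le> 9 * (cmod (h x))\<^sup>2"
        by (simp add: power_mult_distrib)
    qed
  qed auto
  fix \<epsilon> :: real assume "\<epsilon> > 0"
  then have "eventually (\<lambda>i. (LINT x|M. (cmod (h x - F i x))\<^sup>2) < \<epsilon>) sequentially"
    using \<open>(\<lambda>i. LINT x|M. (cmod (h x - F i x))\<^sup>2) \<longlonglongrightarrow> (LINT x|M. 0)\<close>
    by (intro order_tendstoD) auto
  then obtain i where "(LINT x|M. (cmod (h x - F i x))\<^sup>2) < \<epsilon>"
    by (auto simp: eventually_sequentially)
  then show "\<exists>k. rationally_approximable k \<and> (LINT x|M. (cmod (h x - k x))\<^sup>2) < \<epsilon>"
    using rationally_approximable_simple[OF F(1) ap] by blast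
qed

subsection \<open>Rational discrete spectrum\<close>

lemma eigenfunction_L2: "eigenfunction M T c f \<Longrightarrow> f \<in> L2 M"
  by (simp add: eigenfunction_def)

lemma cnj_measurable [measurable]: "cnj \<in> borel_measurable borel"
  by (intro borel_measurable_continuous_onI continuous_intros)

lemma L2_inner_integrable:
  assumes "f \<in> L2 M" "g \<in> L2 M"
  shows "integrable M (\<lambda>x. f x * cnj (g x))"
proof (rule Bochner_Integration.integrable_bound)
  note [measurable] = assms[THEN L2_measurable]
  show "integrable M (\<lambda>x. (cmod (f x))\<^sup>2 + (cmod (g x))\<^sup>2)"
    using assms by (intro Bochner_Integration.integrable_add L2_integrable)
  show "(\<lambda>x. f x * cnj (g x)) \<in> borel_measurable M"
    by measurable
  have "cmod (f x) * cmod (g x) \<le> (cmod (f x))\<^sup>2 + (cmod (g x))\<^sup>2" for x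
  proof -
    have "0 \<le> cmod (f x) * cmod (g x)"
      by simp
    then show ?thesis
      using sum_squares_bound[of "cmod (f x)" "cmod (g x)"] by linarith
  qed
  then show "AE x in M. norm (f x * cnj (g x)) \<le> norm ((cmod (f x))\<^sup>2 + (cmod (g x))\<^sup>2)"
    by (simp add: norm_mult)
qed

text \<open>
  The transformation preserves the inner product but multiplies it by \<open>c * cnj d\<close>. Knowing that \<open>d\<close>
  has modulus one suffices: \<open>c * cnj d = 1\<close> then forces \<open>c = d\<close>.
\<close>

lemma eigenfunctions_orthogonal:
  assumes f: "eigenfunction M T c f" and g: "eigenfunction M T d g"
    and d: "cmod d = 1" and "c \<noteq> d"
  shows "(LINT x|M. f x * cnj (g x)) = 0"
proof -
  note [measurable] = L2_measurable[OF eigenfunction_L2[OF f]] L2_measurable[OF eigenfunction_L2[OF g]]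
  let ?I = "LINT x|M. f x * cnj (g x)"
  have "?I = (LINT x|M. f (T x) * cnj (g (T x)))"
    using integral_funpow[of "\<lambda>x. f x * cnj (g x)" 1] by simp
  also have "\<dots> = (LINT x|M. (c * cnj d) * (f x * cnj (g x)))"
  proof (rule integral_cong_AE)
    have "AE x in M. f (T x) = c * f x" "AE x in M. g (T x) = d * g x"
      using f g by (auto simp: eigenfunction_def)
    then show "AE x in M. f (T x) * cnj (g (T x)) = (c * cnj d) * (f x * cnj (g x))"
      by eventually_elim simp
  qed measurable
  also have "\<dots> = (c * cnj d) * ?I"
    by simp
  finally have "?I = 0 \<or> c * cnj d = 1"
    by (subst (asm) mult_cancel_right1)
  moreover have "c * cnj d \<noteq> 1"
  proof
    assume "c * cnj d = 1"
    then have "d = c * (d * cnj d)"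
      by (simp add: mult.left_commute)
    also have "d * cnj d = 1"
      using d by (simp add: complex_norm_square[symmetric])
    finally show False
      using \<open>c \<noteq> d\<close> by simp
  qed
  ultimately show ?thesis by simp
qed

lemma root_of_unity_cmod: "c ^ q = 1 \<Longrightarrow> q \<ge> 1 \<Longrightarrow> cmod c = (1::real)"
  using power_eq_1_iff[of c q] by auto

lemma orthogonal_distance:
  assumes "f \<in> L2 M" "h \<in> L2 M" "(LINT x|M. f x * cnj (h x)) = 0"
  shows "(LINT x|M. (cmod (f x))\<^sup>2) \<le> (LINT x|M. (cmod (f x - h x))\<^sup>2)"
proof -
  have int: "integrable M (\<lambda>x. Re (f x * cnj (h x)))"
    by (intro integrable_Re L2_inner_integrable assms)
  have "(LINT x|M. Re (f x * cnj (h x))) = Re (LINT x|M. f x * cnj (h x))"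
    by (rule integral_Re[OF L2_inner_integrable[OF assms(1,2)]])
  then have 0: "(LINT x|M. Re (f x * cnj (h x))) = 0"
    using assms(3) by simp
  have "(cmod (a - b))\<^sup>2 = (cmod a)\<^sup>2 + (cmod b)\<^sup>2 - 2 * Re (a * cnj b)" for a b
    unfolding cmod_power2 by (simp add: power2_eq_square algebra_simps)
  then have "(LINT x|M. (cmod (f x - h x))\<^sup>2)
      = (LINT x|M. (cmod (f x))\<^sup>2 + (cmod (h x))\<^sup>2 - 2 * Re (f x * cnj (h x)))"
    by (simp only:)
  also have "\<dots> = (LINT x|M. (cmod (f x))\<^sup>2 + (cmod (h x))\<^sup>2) - (LINT x|M. 2 * Re (f x * cnj (h x)))"
    using assms int by (intro Bochner_Integration.integral_diff Bochner_Integration.integrable_add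
        integrable_mult_right L2_integrable)
  also have "\<dots> = (LINT x|M. (cmod (f x))\<^sup>2) + (LINT x|M. (cmod (h x))\<^sup>2)"
    unfolding integral_mult_right_zero 0
    by (subst Bochner_Integration.integral_add) (use assms in \<open>simp_all add: L2_integrable\<close>)
  finally show ?thesis
    by simp
qed

text \<open>
  An eigenfunction whose eigenvalue is not a root of unity is orthogonal to everything in
  \<open>rational_span\<close>, so by Pythagoras its distance to that set is at least its own norm. Density
  makes the norm zero.
\<close>

lemma eigenvalue_rational:
  assumes ap: "\<forall>B\<in>sets M. almost_periodic_set B"
    and f: "eigenfunction M T c f"
  shows "\<exists>q\<ge>1::nat. c ^ q = 1"
proof (rule ccontr)
  assume irrational: "\<not> (\<exists>q\<ge>1::nat. c ^ q = 1)"
  note L = eigenfunction_L2[OF f]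
  note [measurable] = L2_measurable[OF L]
  let ?I = "LINT x|M. (cmod (f x))\<^sup>2"
  have "?I \<le> \<epsilon>" if "\<epsilon> > 0" for \<epsilon>
  proof -
    obtain t where t: "t \<in> rational_span" "(LINT x|M. (cmod (f x - t x))\<^sup>2) < \<epsilon>"
      by (rule rationally_approximableE[OF rationally_approximable_L2[OF L ap] \<open>\<epsilon> > 0\<close>])
    obtain F a where F: "finite F"
      "\<And>g. g \<in> F \<Longrightarrow> \<exists>d. eigenfunction M T d g \<and> (\<exists>q\<ge>1::nat. d ^ q = 1)"
      and t_eq: "t = (\<lambda>x. \<Sum>g\<in>F. a g * g x)"
      using t(1) by (rule rational_spanE) blast
    have orth: "(LINT x|M. f x * cnj (g x)) = 0" if g: "g \<in> F" for g
    proof -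
      obtain d q where d: "eigenfunction M T d g" "q \<ge> 1" "d ^ q = 1"
        using F(2)[OF g] by blast
      then have "c \<noteq> d"
        using irrational by auto
      then show ?thesis
        by (rule eigenfunctions_orthogonal[OF f d(1) root_of_unity_cmod[OF d(3,2)]])
    qed
    have gL: "g \<in> L2 M" if "g \<in> F" for g
      using F(2)[OF that] eigenfunction_L2 by blast
    have "(LINT x|M. f x * cnj (t x)) = (LINT x|M. (\<Sum>g\<in>F. cnj (a g) * (f x * cnj (g x))))"
      by (simp add: t_eq sum_distrib_left mult.left_commute)
    also have "\<dots> = (\<Sum>g\<in>F. LINT x|M. cnj (a g) * (f x * cnj (g x)))"
      by (intro Bochner_Integration.integral_sum integrable_mult_right L2_inner_integrable L gL)
    also have "\<dots> = 0"
      using orth by simp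
    finally have "?I \<le> (LINT x|M. (cmod (f x - t x))\<^sup>2)"
      by (intro orthogonal_distance L rational_span_L2 t)
    with t(2) show ?thesis by simp
  qed
  then have "?I \<le> 0"
    by (rule dense_ge)
  moreover have "?I \<ge> 0"
    by simp
  ultimately have "?I = 0"
    by linarith
  then have "AE x in M. (cmod (f x))\<^sup>2 = 0"
    using integral_nonneg_eq_0_iff_AE[OF L2_integrable[OF L]] by simp
  then show False
    using f by (simp add: eigenfunction_def)
qed

theorem rational_discrete_spectrum_almost_periodic:
  assumes ap: "\<forall>B\<in>sets M. almost_periodic_set B"
  shows "rational_discrete_spectrum M T"
  unfolding rational_discrete_spectrum_def
proof (intro conjI ballI allI impI)
  fix g and \<epsilon> :: real assume g: "g \<in> L2 M" and "\<epsilon> > 0"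
  obtain t where t: "t \<in> rational_span" "(LINT x|M. (cmod (g x - t x))\<^sup>2) < \<epsilon>\<^sup>2"
    by (rule rationally_approximableE[OF rationally_approximable_L2[OF g ap], of "\<epsilon>\<^sup>2"])
      (use \<open>\<epsilon> > 0\<close> in auto)
  obtain F a where F: "finite F"
    "\<And>f. f \<in> F \<Longrightarrow> \<exists>d. eigenfunction M T d f \<and> (\<exists>q\<ge>1::nat. d ^ q = 1)"
    and t_eq: "t = (\<lambda>x. \<Sum>f\<in>F. a f * f x)"
    using t(1) by (rule rational_spanE) blast
  have "L2_norm M (\<lambda>x. g x - t x) < \<epsilon>"
    unfolding L2_norm_def using real_sqrt_less_mono[OF t(2)] \<open>\<epsilon> > 0\<close> by simp
  then show "\<exists>F a. finite F \<and> (\<forall>f\<in>F. \<exists>c. eigenfunction M T c f) \<and>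
      L2_norm M (\<lambda>x. g x - (\<Sum>f\<in>F. a f * f x)) < \<epsilon>"
    using F(1) F(2) unfolding t_eq by (intro exI[of _ F] exI[of _ a] conjI ballI) blast+
qed (rule eigenvalue_rational[OF ap])

subsection \<open>A criterion for ergodicity\<close>

text \<open>
  For an invariant set \<open>B\<close> the correlations of \<open>B\<close> with \<open>T^{-m} C\<close> do not depend on \<open>m\<close>. Averaging over
  \<open>m\<close> replaces the indicator of \<open>C\<close> by nearly a constant, so \<open>B\<close> is independent of each \<open>C\<close> in \<open>G\<close>.
  Independence passes from the generator to all measurable sets, in particular to \<open>B\<close> itself.
\<close>

theorem ergodic_if_averages_converge:
  assumes G: "Int_stable G" "G \<subseteq> Pow (space M)" "sets M = sigma_sets (space M) G"
    and avg: "\<And>C \<epsilon>. C \<in> G \<Longrightarrow> \<epsilon> > 0 \<Longrightarrow>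
      \<exists>N\<ge>1. (LINT x|M. \<bar>ergodic_average 1 C N x - measure M C\<bar>) \<le> \<epsilon>"
  shows "ergodic M T"
  unfolding ergodic_def
proof (intro ballI impI)
  fix B assume [measurable]: "B \<in> sets M" and inv: "T -` B \<inter> space M = B"
  have B_iff: "(T ^^ n) x \<in> B \<longleftrightarrow> x \<in> B" if "x \<in> space M" for n x
  proof (induction n)
    case (Suc n)
    then show ?case
      using inv funpow_space[OF that, of n] by auto
  qed simp
  have "measure M (B \<inter> C) = measure M B * measure M C" if "C \<in> sets M" for C
    using G(1,2) that[unfolded G(3)]
  proof (induction rule: sigma_sets_induct_disjoint)
    case (basic C)
    then have C [measurable]: "C \<in> sets M"
      unfolding G(3) by (rule sigma_sets.Basic)
    have shift: "(LINT x|M. indicat_real B x * indicat_real C ((T ^^ m) x)) = measure M (B \<inter> C)" for m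
    proof -
      have "(LINT x|M. indicat_real B x * indicat_real C ((T ^^ m) x))
          = (LINT x|M. indicat_real (B \<inter> C) ((T ^^ m) x))"
        by (intro Bochner_Integration.integral_cong) (auto simp: B_iff indicator_def)
      also have "\<dots> = measure M (B \<inter> C)"
        by (subst integral_funpow) (auto simp: Int_absorb2 sets.sets_into_space)
      finally show ?thesis .
    qed
    have int: "integrable M (\<lambda>x. indicat_real B x * indicat_real C ((T ^^ m) x))" for m
      by (rule integrable_bdd[of _ 1]) (auto simp: indicator_def)
    have "\<bar>measure M (B \<inter> C) - measure M B * measure M C\<bar> \<le> \<epsilon>" if \<epsilon>: "\<epsilon> > 0" for \<epsilon>
    proof -
      obtain N where N: "N \<ge> 1" "(LINT x|M. \<bar>ergodic_average 1 C N x - measure M C\<bar>) \<le> \<epsilon>"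
        using avg[OF basic \<epsilon>] by blast
      have int2: "integrable M (\<lambda>x. indicat_real B x * ergodic_average 1 C N x)"
        using ergodic_average_bounds[of 1 C N]
        by (intro integrable_bdd[of _ 1]) (auto simp: indicator_def)
      have "(LINT x|M. indicat_real B x * ergodic_average 1 C N x)
          = (LINT x|M. (\<Sum>m<N. indicat_real B x * indicat_real C ((T ^^ m) x)) / real N)"
        by (simp add: ergodic_average_def sum_distrib_left)
      also have "\<dots> = (\<Sum>m<N. LINT x|M. indicat_real B x * indicat_real C ((T ^^ m) x)) / real N"
        using int by (simp add: Bochner_Integration.integral_sum del: sum_mult_indicator sum_indicator_mult)
      also have "\<dots> = measure M (B \<inter> C)"
        using N by (simp add: shift)
      finally have 1: "(LINT x|M. indicat_real B x * ergodic_average 1 C N x) = measure M (B \<inter> C)" .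
      have 2: "(LINT x|M. indicat_real B x * measure M C) = measure M B * measure M C"
        by (simp add: Int_absorb2 sets.sets_into_space)
      have int3: "integrable M (\<lambda>x. indicat_real B x * measure M C)"
        by (rule integrable_bdd[of _ 1]) (auto simp: indicator_def)
      have "measure M (B \<inter> C) - measure M B * measure M C
          = (LINT x|M. indicat_real B x * ergodic_average 1 C N x - indicat_real B x * measure M C)"
        by (simp only: Bochner_Integration.integral_diff[OF int2 int3] 1 2)
      then have "\<bar>measure M (B \<inter> C) - measure M B * measure M C\<bar>
          \<le> (LINT x|M. \<bar>indicat_real B x * ergodic_average 1 C N x - indicat_real B x * measure M C\<bar>)"
        by (simp only: integral_abs_bound)
      also have "\<dots> \<le> (LINT x|M. \<bar>ergodic_average 1 C N x - measure M C\<bar>)"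
      proof (intro integral_mono integrable_abs Bochner_Integration.integrable_diff int2 int3
          ergodic_average_integrable[OF C] integrable_const)
        show "\<bar>indicat_real B x * ergodic_average 1 C N x - indicat_real B x * measure M C\<bar>
            \<le> \<bar>ergodic_average 1 C N x - measure M C\<bar>" for x
          by (cases "x \<in> B") auto
      qed
      finally show ?thesis
        using N(2) by simp
    qed
    then have "\<bar>measure M (B \<inter> C) - measure M B * measure M C\<bar> \<le> 0"
      by (rule dense_ge)
    then show ?case
      by simp
  next
    case (compl C)
    then have [measurable]: "C \<in> sets M"
      by (simp add: G(3))
    have "B \<inter> (space M - C) = B - B \<inter> C"
      using sets.sets_into_space[of B M] by auto
    then show ?case
      using compl by (simp add: finite_measure_Diff prob_compl algebra_simps)
  next
    case (union C)
    then have [measurable]: "C i \<in> sets M" for i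
      by (auto simp: G(3))
    have "(\<lambda>i. measure M (B \<inter> C i)) sums measure M (\<Union>i. B \<inter> C i)"
      using union(1) by (intro finite_measure_UNION) (auto simp: disjoint_family_on_def)
    then have "(\<lambda>i. measure M B * measure M (C i)) sums measure M (B \<inter> (\<Union>i. C i))"
      using union(3) by simp
    moreover have "(\<lambda>i. measure M B * measure M (C i)) sums (measure M B * measure M (\<Union>i. C i))"
      using union(1) by (intro sums_mult finite_measure_UNION) auto
    ultimately show ?case
      by (rule sums_unique2)
  qed simp
  from this[OF \<open>B \<in> sets M\<close>] have "measure M B = measure M B * measure M B"
    unfolding Int_absorb .
  then show "measure M B = 0 \<or> measure M B = 1"
    by (subst (asm) mult_cancel_left1)
qed

end

section \<open>Cylinder sets of two-sided sequences\<close>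

text \<open>
  The windows \<open>[-L, L]\<close> increase with \<open>L\<close> and exhaust the integers, so any finite set of coordinates
  may be replaced by one of them.
\<close>

definition agree :: "nat \<Rightarrow> (int \<Rightarrow> 'a) \<Rightarrow> (int \<Rightarrow> 'a) \<Rightarrow> bool" where
  "agree L x y \<longleftrightarrow> (\<forall>i. \<bar>i\<bar> \<le> int L \<longrightarrow> x i = y i)"

definition finitely_determined :: "((int \<Rightarrow> 'a) \<Rightarrow> 'b) \<Rightarrow> bool" where
  "finitely_determined f \<longleftrightarrow> (\<exists>L. \<forall>x y. agree L x y \<longrightarrow> f x = f y)"

definition cylinders :: "(int \<Rightarrow> 'a) set set" where
  "cylinders = {A. finitely_determined (\<lambda>x. x \<in> A)}"

lemma agree_mono: "agree L x y \<Longrightarrow> K \<le> L \<Longrightarrow> agree K x y"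
  by (auto simp: agree_def)

lemma agree_sym: "agree L x y \<Longrightarrow> agree L y x"
  by (auto simp: agree_def)

lemma agree_refl: "agree L x x"
  by (auto simp: agree_def)

lemma agree_trans: "agree L x y \<Longrightarrow> agree L y z \<Longrightarrow> agree L x z"
  by (auto simp: agree_def)

lemma finitely_determinedI: "(\<And>x y. agree L x y \<Longrightarrow> f x = f y) \<Longrightarrow> finitely_determined f"
  by (auto simp: finitely_determined_def)

lemma finitely_determined_const [simp]: "finitely_determined (\<lambda>x. c)"
  by (simp add: finitely_determined_def)

lemma finitely_determined_comp: "finitely_determined f \<Longrightarrow> finitely_determined (\<lambda>x. h (f x))"
  unfolding finitely_determined_def by metis

lemma finitely_determined_pair:
  assumes "finitely_determined f" "finitely_determined g"
  shows "finitely_determined (\<lambda>x. h (f x) (g x))"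
proof -
  obtain K L where "\<And>x y. agree K x y \<Longrightarrow> f x = f y" "\<And>x y. agree L x y \<Longrightarrow> g x = g y"
    using assms unfolding finitely_determined_def by metis
  then show ?thesis
    by (intro finitely_determinedI[of "max K L"]) (metis agree_mono max.cobounded1 max.cobounded2)
qed

lemma finitely_determined_sum:
  assumes "finite I" "\<And>i. i \<in> I \<Longrightarrow> finitely_determined (f i)"
  shows "finitely_determined (\<lambda>x. \<Sum>i\<in>I. f i x)"
  using assms by (induction I rule: finite_induct) (auto intro: finitely_determined_pair)

lemma funpow_left_shift: "(left_shift ^^ n) x i = x (i + int n)"
  by (induction n arbitrary: i) (auto simp: left_shift_def algebra_simps)

lemma finitely_determined_shift:
  assumes "finitely_determined f"
  shows "finitely_determined (\<lambda>x. f ((left_shift ^^ n) x))"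
proof -
  obtain L where L: "\<And>x y. agree L x y \<Longrightarrow> f x = f y"
    using assms unfolding finitely_determined_def by metis
  show ?thesis
    by (intro finitely_determinedI[of "L + n"] L) (auto simp: agree_def funpow_left_shift)
qed

lemma cylinders_iff: "A \<in> cylinders \<longleftrightarrow> finitely_determined (\<lambda>x. x \<in> A)"
  by (simp add: cylinders_def)

lemma cylinders_Int: "A \<in> cylinders \<Longrightarrow> B \<in> cylinders \<Longrightarrow> A \<inter> B \<in> cylinders"
  and cylinders_Un: "A \<in> cylinders \<Longrightarrow> B \<in> cylinders \<Longrightarrow> A \<union> B \<in> cylinders"
  and cylinders_Diff: "A \<in> cylinders \<Longrightarrow> B \<in> cylinders \<Longrightarrow> A - B \<in> cylinders"
  unfolding cylinders_iff Int_iff Un_iff Diff_iff by (rule finitely_determined_pair; assumption)+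

lemma cylinders_UNIV: "UNIV \<in> cylinders" and cylinders_empty: "{} \<in> cylinders"
  by (simp_all add: cylinders_iff)

lemma cylinders_shift: "A \<in> cylinders \<Longrightarrow> (left_shift ^^ n) -` A \<in> cylinders"
  using finitely_determined_shift[of "\<lambda>x. x \<in> A" n] by (simp add: cylinders_iff)

lemma Int_stable_cylinders: "Int_stable cylinders"
  by (auto simp: Int_stable_def cylinders_Int)

subsection \<open>Topology\<close>

lemma agree_open:
  fixes x :: "int \<Rightarrow> 'a :: discrete_topology"
  shows "open {y. agree L x y}"
proof -
  have "open {y. \<forall>i\<in>{- int L..int L}. y (id i) \<in> {x i}}"
    by (rule product_topology_basis') (simp_all add: discrete_topology_class.open_discrete)
  also have "{y. \<forall>i\<in>{- int L..int L}. y (id i) \<in> {x i}} = {y. agree L x y}"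
    by (auto simp: agree_def abs_le_iff)
  finally show ?thesis .
qed

lemma cylinders_open:
  fixes A :: "(int \<Rightarrow> 'a :: discrete_topology) set"
  assumes "A \<in> cylinders"
  shows "open A"
proof -
  obtain L where L: "\<And>x y. agree L x y \<Longrightarrow> x \<in> A \<longleftrightarrow> y \<in> A"
    using assms unfolding cylinders_iff finitely_determined_def by metis
  have "A = (\<Union>x\<in>A. {y. agree L x y})"
    using L by (auto intro: agree_refl)
  also have "open \<dots>"
    by (intro open_UN ballI agree_open)
  finally show ?thesis .
qed

text \<open>
  A basic open set of the product topology restricts only finitely many coordinates, and these lie in
  some window.
\<close>

lemma open_contains_window:
  fixes U :: "(int \<Rightarrow> 'a :: topological_space) set"
  assumes "open U" "x \<in> U"
  obtains L where "\<And>y. agree L x y \<Longrightarrow> y \<in> U"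
proof -
  obtain X where X: "x \<in> (\<Pi>\<^sub>E i\<in>UNIV. X i)" "finite {i. X i \<noteq> (UNIV :: 'a set)}"
    "(\<Pi>\<^sub>E i\<in>UNIV. X i) \<subseteq> U"
    using product_topology_open_contains_basis[OF assms(1)[unfolded open_fun_def] assms(2)] by auto
  obtain L where L: "\<And>i. X i \<noteq> UNIV \<Longrightarrow> \<bar>i\<bar> \<le> int L"
  proof -
    have fin: "finite ((\<lambda>i. nat \<bar>i\<bar>) ` {i. X i \<noteq> UNIV})"
      using X(2) by simp
    have "\<bar>i\<bar> \<le> int (Max ((\<lambda>i. nat \<bar>i\<bar>) ` {i. X i \<noteq> UNIV}))" if "X i \<noteq> UNIV" for i
      using Max_ge[OF fin, of "nat \<bar>i\<bar>"] that by auto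
    then show thesis by (rule that)
  qed
  show thesis
  proof (rule that)
    fix y assume y: "agree L x y"
    have "y i \<in> X i" for i
    proof (cases "X i = UNIV")
      case False
      then have "y i = x i"
        using L y by (auto simp: agree_def)
      then show ?thesis
        using X(1) by (auto simp: PiE_iff)
    qed simp
    then show "y \<in> U"
      using X(3) by (auto simp: PiE_iff)
  qed
qed

lemma compact_sequences: "compact (UNIV :: (int \<Rightarrow> 'a :: {finite, topological_space}) set)"
proof -
  have "compact_space (euclidean :: 'a topology)"
    by (simp add: compact_space_def finite_imp_compact)
  then have "compact_space (product_topology (\<lambda>i::int. euclidean :: 'a topology) UNIV)"
    by (subst compact_space_product_topology) simp
  then show ?thesis
    by (simp add: euclidean_product_topology compact_space_def)
qed

lemma finite_subcover_incseq:
  assumes "compact K" "incseq A" "\<And>n. open (A n)" "K \<subseteq> (\<Union>n. A n)"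
  obtains n :: nat where "K \<subseteq> A n"
proof -
  obtain I where I: "finite I" "K \<subseteq> (\<Union>n\<in>I. A n)"
    by (rule compactE_image[OF assms(1), of UNIV A]) (use assms in auto)
  have "A i \<subseteq> A (Max (insert 0 I))" if "i \<in> I" for i
    using I that by (intro incseqD[OF assms(2)] Max_ge) auto
  then have "K \<subseteq> A (Max (insert 0 I))"
    using I by blast
  then show thesis ..
qed

text \<open>
  This is the continuity at the empty set that Caratheodory's theorem asks for, in its strongest
  form. It is compactness, since cylinder sets are closed.
\<close>

lemma decseq_cylinders_empty:
  fixes A :: "nat \<Rightarrow> (int \<Rightarrow> 'a :: {finite, discrete_topology}) set"
  assumes A: "\<And>n. A n \<in> cylinders" and dec: "decseq A" and empty: "(\<Inter>n. A n) = {}"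
  obtains n where "A n = {}"
proof -
  have "open (UNIV - A n)" for n
    by (intro cylinders_open cylinders_Diff cylinders_UNIV A)
  moreover have "incseq (\<lambda>n. UNIV - A n)"
    using dec by (auto simp: incseq_def decseq_def)
  moreover have "UNIV \<subseteq> (\<Union>n. UNIV - A n)"
    using empty by blast
  ultimately obtain n where "UNIV \<subseteq> UNIV - A n"
    using finite_subcover_incseq[OF compact_sequences] by blast
  then show thesis
    using that by blast
qed

text \<open>
  An open set \<open>U\<close> is the union over \<open>L\<close> of the sets of points whose \<open>L\<close>-window already forces
  membership in \<open>U\<close>. Each of these is a cylinder set, and there are only countably many of them.
\<close>

lemma sets_borel_cylinders:
  "sets (borel :: (int \<Rightarrow> 'a :: discrete_topology) measure) = sigma_sets UNIV cylinders"
proof (rule equalityI)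
  have "cylinders \<subseteq> sets (borel :: (int \<Rightarrow> 'a) measure)"
    by (intro subsetI borel_open cylinders_open)
  from sets.sigma_sets_subset[OF this]
  show "sigma_sets UNIV cylinders \<subseteq> sets (borel :: (int \<Rightarrow> 'a) measure)"
    unfolding space_borel .
  have "U \<in> sigma_sets UNIV cylinders" if U: "open U" for U :: "(int \<Rightarrow> 'a) set"
  proof -
    define V where "V L = {x. \<forall>y. agree L x y \<longrightarrow> y \<in> U}" for L
    have "V L \<in> cylinders" for L
      unfolding cylinders_iff V_def
      by (rule finitely_determinedI[of L]) (unfold mem_Collect_eq, meson agree_sym agree_trans)
    moreover have "U = (\<Union>L. V L)"
    proof (intro equalityI subsetI)
      fix x assume "x \<in> U"
      then obtain L where "\<And>y. agree L x y \<Longrightarrow> y \<in> U"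
        using open_contains_window[OF U] by blast
      then show "x \<in> (\<Union>L. V L)"
        by (auto simp: V_def)
    qed (auto simp: V_def agree_refl)
    ultimately show ?thesis
      by (metis sigma_sets.Basic sigma_sets.Union)
  qed
  then show "sets (borel :: (int \<Rightarrow> 'a) measure) \<subseteq> sigma_sets UNIV cylinders"
    unfolding borel_def by (auto intro!: sigma_sets_mono)
qed

lemma cylinders_borel [measurable]:
  "(A :: (int \<Rightarrow> 'a :: discrete_topology) set) \<in> cylinders \<Longrightarrow> A \<in> sets borel"
  by (intro borel_open cylinders_open)

lemma left_shift_measurable [measurable]:
  "left_shift \<in> measurable borel (borel :: (int \<Rightarrow> 'a :: discrete_topology) measure)"
proof (rule measurable_sigma_sets[OF sets_borel_cylinders])
  fix A :: "(int \<Rightarrow> 'a) set" assume "A \<in> cylinders"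
  then show "left_shift -` A \<inter> space borel \<in> sets borel"
    using cylinders_shift[of A 1] by (auto intro: cylinders_open)
qed auto

lemma finitely_determined_finite_range:
  fixes f :: "(int \<Rightarrow> 'a :: finite) \<Rightarrow> 'b"
  assumes "finitely_determined f"
  shows "finite (range f)"
proof -
  obtain L where L: "\<And>x y. agree L x y \<Longrightarrow> f x = f y"
    using assms unfolding finitely_determined_def by metis
  define H where "H = {h :: int \<Rightarrow> 'a. \<forall>i. (i \<in> {- int L..int L} \<longrightarrow> h i \<in> UNIV)
    \<and> (i \<notin> {- int L..int L} \<longrightarrow> h i = undefined)}"
  have "finite H"
    unfolding H_def by (rule finite_set_of_finite_funs) auto
  moreover have "range f \<subseteq> f ` H"
  proof
    fix v assume "v \<in> range f"
    then obtain x where x: "v = f x" by blast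
    define h where "h i = (if i \<in> {- int L..int L} then x i else undefined)" for i
    have "v = f h"
      unfolding x by (rule L) (auto simp: agree_def h_def)
    then show "v \<in> f ` H"
      by (auto simp: h_def H_def)
  qed
  ultimately show ?thesis
    by (meson finite_imageI finite_subset)
qed

lemma finitely_determined_level_set: "finitely_determined f \<Longrightarrow> f -` B \<in> cylinders"
  using finitely_determined_comp[of f "\<lambda>v. v \<in> B"] by (simp add: cylinders_iff)

lemma finitely_determined_measurable:
  fixes f :: "(int \<Rightarrow> 'a :: {finite, discrete_topology}) \<Rightarrow> 'b"
  assumes "finitely_determined f" "range f \<subseteq> space N"
  shows "f \<in> measurable borel N"
  using assms finitely_determined_level_set[OF assms(1)] by (intro measurableI) (auto intro: cylinders_open)

text \<open>
  The sets \<open>W L\<close>, on which the \<open>L\<close>-window determines \<open>f\<close> up to \<open>\<epsilon>\<close>, increase to the whole space and are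
  open; by compactness one of them is everything. This is uniform continuity of \<open>f\<close> without a metric
  on the sequence space.
\<close>

lemma continuous_finitely_determined_approximation:
  fixes f :: "(int \<Rightarrow> 'a :: {finite, discrete_topology}) \<Rightarrow> 'b :: real_normed_vector"
  assumes f: "continuous_on UNIV f" and "\<epsilon> > 0"
  obtains g where "finitely_determined g" "\<And>x. norm (f x - g x) < \<epsilon>"
proof -
  define W where "W L = {x. \<forall>y z. agree L x y \<longrightarrow> agree L x z \<longrightarrow> norm (f y - f z) < \<epsilon>}" for L
  have "W L \<in> cylinders" for L
    unfolding cylinders_iff W_def
    by (rule finitely_determinedI[of L]) (unfold mem_Collect_eq, meson agree_sym agree_trans)
  then have "open (W L)" for L
    by (rule cylinders_open)
  moreover have "incseq W"
    unfolding incseq_def W_def by (auto dest: agree_mono)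
  moreover have "UNIV \<subseteq> (\<Union>L. W L)"
  proof
    fix x
    have "open (f -` ball (f x) (\<epsilon> / 2))"
      using f by (simp add: continuous_on_open_vimage)
    moreover have "x \<in> f -` ball (f x) (\<epsilon> / 2)"
      using \<open>\<epsilon> > 0\<close> by simp
    ultimately obtain L where L: "\<And>y. agree L x y \<Longrightarrow> y \<in> f -` ball (f x) (\<epsilon> / 2)"
      by (rule open_contains_window) blast
    have "norm (f y - f z) < \<epsilon>" if "agree L x y" "agree L x z" for y z
      using dist_triangle_half_r[of "f x" "f y" \<epsilon> "f z"] L[OF that(1)] L[OF that(2)]
      by (simp add: dist_norm)
    then show "x \<in> (\<Union>L. W L)"
      by (auto simp: W_def)
  qed
  ultimately obtain L where L: "UNIV \<subseteq> W L"
    using finite_subcover_incseq[OF compact_sequences] by blast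
  define c where "c x = (\<lambda>i. if \<bar>i\<bar> \<le> int L then x i else undefined)" for x :: "int \<Rightarrow> 'a"
  show thesis
  proof (rule that[of "\<lambda>x. f (c x)"])
    have "c x = c y" if "agree L x y" for x y
      using that by (auto simp: c_def agree_def)
    then show "finitely_determined (\<lambda>x. f (c x))"
      by (intro finitely_determinedI[of L]) metis
    have "agree L x (c x)" for x
      by (auto simp: agree_def c_def)
    then show "norm (f x - f (c x)) < \<epsilon>" for x
      using L agree_refl[of L x] by (auto simp: W_def)
  qed
qed

section \<open>Almost periodic sequences of truth values\<close>

lemma sum_lessThan_split: "(\<Sum>n<m + N. f n) = (\<Sum>n<m. f n) + (\<Sum>n<N. f (n + m))"
  for f :: "nat \<Rightarrow> real"
  by (induction N) (simp_all add: ac_simps)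

lemma sum_shift_le:
  fixes f :: "nat \<Rightarrow> real"
  assumes "\<And>n. f n \<ge> 0"
  shows "(\<Sum>n<N. f (n + m)) \<le> (\<Sum>n<m + N. f n)"
  unfolding sum_lessThan_split by (simp add: assms sum_nonneg)

lemma bounded_over_n_tendsto_0: "(\<lambda>N. K / real N) \<longlonglongrightarrow> 0"
  by (rule tendsto_divide_0[OF tendsto_const]) (simp add: filterlim_real_sequentially filterlim_at_top_imp_at_infinity)

lemma average_limit_cong:
  fixes f g :: "nat \<Rightarrow> real"
  assumes "(\<lambda>N. f N / real N) \<longlonglongrightarrow> a" "\<And>N. \<bar>f N - g N\<bar> \<le> K"
  shows "(\<lambda>N. g N / real N) \<longlonglongrightarrow> a"
proof -
  have "(\<lambda>N. f N / real N - g N / real N) \<longlonglongrightarrow> 0"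
  proof (rule Lim_null_comparison[OF _ bounded_over_n_tendsto_0])
    show "\<forall>\<^sub>F N in sequentially. norm (f N / real N - g N / real N) \<le> K / real N"
      using assms(2) by (auto simp: divide_right_mono simp flip: diff_divide_distrib)
  qed
  then show ?thesis
    using assms(1) by (rule Lim_transform2[rotated])
qed

lemma average_limit_le:
  fixes f :: "nat \<Rightarrow> real"
  assumes "(\<lambda>N. f N / real N) \<longlonglongrightarrow> a" "\<And>N. f N \<le> \<epsilon> * real N + C"
  shows "a \<le> \<epsilon>"
proof (rule LIMSEQ_le[OF assms(1)])
  show "(\<lambda>N. \<epsilon> + C / real N) \<longlonglongrightarrow> \<epsilon>"
    using tendsto_add[OF tendsto_const bounded_over_n_tendsto_0, of \<epsilon> C] by simp
  have "f N / real N \<le> \<epsilon> + C / real N" if "N \<ge> 1" for N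
    using assms(2)[of N] that by (simp add: field_simps)
  then show "\<exists>N. \<forall>n\<ge>N. f n / real n \<le> \<epsilon> + C / real n"
    by blast
qed

text \<open>
  Closeness in density is expressed by linear bounds \<open>\<epsilon> * N + C\<close> on the number of exceptions below
  \<open>N\<close>. These add up, and they absorb shifts of the index and finitely many exceptions into \<open>C\<close>, which
  makes them easier to handle than upper limits.
\<close>

definition mean_almost_periodic :: "(nat \<Rightarrow> bool) \<Rightarrow> bool" where
  "mean_almost_periodic a \<longleftrightarrow> (\<forall>\<epsilon>>0. \<exists>p u C. p \<ge> 1 \<and> (\<forall>n. u (n + p) = u n) \<and>
     (\<forall>N. (\<Sum>n<N. of_bool (a n \<noteq> u n)) \<le> \<epsilon> * real N + C))"

lemma mean_almost_periodicE:
  assumes "mean_almost_periodic a" "\<epsilon> > 0"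
  obtains p u C where "p \<ge> 1" "\<And>n. u (n + p) = u n"
    "\<And>N. (\<Sum>n<N. of_bool (a n \<noteq> u n)) \<le> \<epsilon> * real N + C"
  using assms unfolding mean_almost_periodic_def by metis

lemma near_periodic_sum:
  assumes p: "p \<ge> 1" and u: "\<And>n. u (n + p) = u n"
    and dev: "\<And>N. (\<Sum>n<N. of_bool (a n \<noteq> u n)) \<le> \<epsilon> * real N + C"
  shows "\<bar>(\<Sum>n<N. of_bool (a n)) - real N * ((\<Sum>n<p. of_bool (u n)) / real p)\<bar>
    \<le> \<epsilon> * real N + (C + real p)"
proof -
  have "\<bar>(\<Sum>n<N. of_bool (a n)) - (\<Sum>n<N. of_bool (u n) :: real)\<bar> \<le> (\<Sum>n<N. of_bool (a n \<noteq> u n))"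
    unfolding sum_subtractf[symmetric] by (rule order_trans[OF sum_abs sum_mono]) auto
  moreover have "\<bar>(\<Sum>n<N. of_bool (u (0 + n))) - real N * ((\<Sum>n<p. of_bool (u n)) / real p)\<bar> \<le> real p"
    by (rule periodic_sum_mean[OF p]) (auto simp: u)
  ultimately show ?thesis
    using dev[of N] by (simp only: add_0)
qed

lemma near_periodic_mean:
  assumes p: "p \<ge> 1" and u: "\<And>n. u (n + p) = u n"
    and dev: "\<And>N. (\<Sum>n<N. of_bool (a n \<noteq> u n)) \<le> \<epsilon> * real N + C"
    and lim: "(\<lambda>N. (\<Sum>n<N. of_bool (a n)) / real N) \<longlonglongrightarrow> c"
  shows "\<bar>c - (\<Sum>n<p. of_bool (u n)) / real p\<bar> \<le> \<epsilon>"
proof (rule average_limit_le)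
  let ?m = "(\<Sum>n<p. of_bool (u n)) / real p"
  show "\<bar>(\<Sum>n<N. of_bool (a n)) - real N * ?m\<bar> \<le> \<epsilon> * real N + (C + real p)" for N
    by (rule near_periodic_sum[OF p u dev])
  have "(\<lambda>N. \<bar>(\<Sum>n<N. of_bool (a n)) / real N - ?m\<bar>) \<longlonglongrightarrow> \<bar>c - ?m\<bar>"
    by (intro tendsto_intros lim)
  moreover have "\<forall>\<^sub>F N in sequentially. \<bar>(\<Sum>n<N. of_bool (a n)) / real N - ?m\<bar>
      = \<bar>(\<Sum>n<N. of_bool (a n)) - real N * ?m\<bar> / real N"
    using eventually_gt_at_top[of 0]
  proof eventually_elim
    case (elim N)
    then have "(\<Sum>n<N. of_bool (a n)) / real N - ?m = ((\<Sum>n<N. of_bool (a n)) - real N * ?m) / real N"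
      by (simp add: diff_divide_distrib)
    then show ?case by simp
  qed
  ultimately show "(\<lambda>N. \<bar>(\<Sum>n<N. of_bool (a n)) - real N * ?m\<bar> / real N) \<longlonglongrightarrow> \<bar>c - ?m\<bar>"
    by (simp add: tendsto_cong)
qed

lemma mean_almost_periodic_convergent:
  assumes a: "mean_almost_periodic a"
  shows "convergent (\<lambda>N. (\<Sum>n<N. of_bool (a n)) / real N)"
proof (rule Cauchy_convergent, rule metric_CauchyI)
  fix e :: real assume "e > 0"
  obtain p u C where p: "p \<ge> 1" and u: "\<And>n. u (n + p) = u n"
    and dev: "\<And>N. (\<Sum>n<N. of_bool (a n \<noteq> u n)) \<le> (e / 5) * real N + C"
    by (rule mean_almost_periodicE[OF a, of "e / 5"]) (use \<open>e > 0\<close> in auto)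
  let ?m = "(\<Sum>n<p. of_bool (u n)) / real p"
  obtain K where K: "real K > (C + real p) / (e / 5)"
    using reals_Archimedean2 by blast
  have near: "\<bar>(\<Sum>n<N. of_bool (a n)) / real N - ?m\<bar> \<le> 2 * e / 5" if "N \<ge> max 1 K" for N
  proof -
    have N: "real N > 0" "real N \<ge> real K"
      using that by auto
    have "(C + real p) / (e / 5) \<le> real N"
      using K N by linarith
    then have "C + real p \<le> (e / 5) * real N"
      using \<open>e > 0\<close> by (simp add: field_simps)
    then have *: "\<bar>(\<Sum>n<N. of_bool (a n)) - real N * ?m\<bar> \<le> (2 * e / 5) * real N"
      using near_periodic_sum[OF p u dev, of N] by simp
    have "(\<Sum>n<N. of_bool (a n)) / real N - ?m = ((\<Sum>n<N. of_bool (a n)) - real N * ?m) / real N"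
      using N by (simp add: diff_divide_distrib)
    then have "\<bar>(\<Sum>n<N. of_bool (a n)) / real N - ?m\<bar>
        = \<bar>(\<Sum>n<N. of_bool (a n)) - real N * ?m\<bar> / real N"
      by simp
    also have "\<dots> \<le> 2 * e / 5"
      using * N by (simp add: pos_divide_le_eq)
    finally show ?thesis .
  qed
  have "dist ((\<Sum>n<N. of_bool (a n)) / real N) ((\<Sum>n<K'. of_bool (a n)) / real K') < e"
    if "N \<ge> max 1 K" "K' \<ge> max 1 K" for N K'
    using near[OF that(1)] near[OF that(2)] \<open>e > 0\<close> unfolding dist_real_def by linarith
  then show "\<exists>M. \<forall>m\<ge>M. \<forall>n\<ge>M.
      dist ((\<Sum>n<m. of_bool (a n)) / real m) ((\<Sum>k<n. of_bool (a k)) / real n) < e"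
    by blast
qed

lemma mean_almost_periodic_almost_periods:
  assumes a: "mean_almost_periodic a" and "\<epsilon> > 0"
  obtains p where "p \<ge> 1"
    "\<And>m. \<exists>C. \<forall>N. (\<Sum>n<N. of_bool (a (n + p * m) \<noteq> a n)) \<le> \<epsilon> * real N + C"
proof -
  obtain p u C where p: "p \<ge> 1" and u: "\<And>n. u (n + p) = u n"
    and dev: "\<And>N. (\<Sum>n<N. of_bool (a n \<noteq> u n)) \<le> (\<epsilon> / 2) * real N + C"
    by (rule mean_almost_periodicE[OF a, of "\<epsilon> / 2"]) (use \<open>\<epsilon> > 0\<close> in auto)
  show thesis
  proof (rule that[OF p])
    fix m
    have u': "u (n + p * m) = u n" for n
    proof (induction m)
      case (Suc m)
      then show ?case
        using u[of "n + p * m"] by (simp add: ac_simps)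
    qed simp
    have "(\<Sum>n<N. of_bool (a (n + p * m) \<noteq> a n)) \<le> \<epsilon> * real N + ((\<epsilon> / 2) * real (p * m) + 2 * C)" for N
    proof -
      have "(\<Sum>n<N. of_bool (a (n + p * m) \<noteq> a n) :: real)
          \<le> (\<Sum>n<N. of_bool (a (n + p * m) \<noteq> u (n + p * m)) + of_bool (a n \<noteq> u n))"
        by (intro sum_mono) (auto simp: u')
      also have "\<dots> \<le> (\<Sum>n<p * m + N. of_bool (a n \<noteq> u n)) + (\<Sum>n<N. of_bool (a n \<noteq> u n))"
        unfolding sum.distrib by (intro add_right_mono sum_shift_le) auto
      also have "\<dots> \<le> ((\<epsilon> / 2) * real (p * m + N) + C) + ((\<epsilon> / 2) * real N + C)"
        by (intro add_mono dev)
      finally show ?thesis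
        by (simp add: algebra_simps)
    qed
    then show "\<exists>C. \<forall>N. (\<Sum>n<N. of_bool (a (n + p * m) \<noteq> a n)) \<le> \<epsilon> * real N + C"
      by blast
  qed
qed

text \<open>
  A window of length \<open>K\<close> much longer than the period averages the periodic approximation nearly to its
  mean, for every starting point \<open>n\<close>. The exceptions at which \<open>a\<close> differs from the approximation are
  each counted by at most \<open>K\<close> windows with weight \<open>1 / K\<close>, so they contribute no more than their own
  density.
\<close>

lemma mean_almost_periodic_uniform_averages:
  assumes a: "mean_almost_periodic a" and "\<epsilon> > 0"
    and lim: "(\<lambda>N. (\<Sum>n<N. of_bool (a n)) / real N) \<longlonglongrightarrow> c"
  obtains K C where "K \<ge> 1"
    "\<And>N. (\<Sum>n<N. \<bar>(\<Sum>m<K. of_bool (a (n + m))) / real K - c\<bar>) \<le> \<epsilon> * real N + C"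
proof -
  define e where "e = \<epsilon> / 3"
  have "e > 0"
    using \<open>\<epsilon> > 0\<close> by (simp add: e_def)
  obtain p u C where p: "p \<ge> 1" and u: "\<And>n. u (n + p) = u n"
    and dev: "\<And>N. (\<Sum>n<N. of_bool (a n \<noteq> u n)) \<le> e * real N + C"
    by (rule mean_almost_periodicE[OF a \<open>e > 0\<close>]) blast
  let ?m = "(\<Sum>n<p. of_bool (u n)) / real p"
  have cm: "\<bar>c - ?m\<bar> \<le> e"
    by (rule near_periodic_mean[OF p u dev lim])
  \<comment> \<open>The window is so long that an incomplete period costs at most \<open>e\<close> in the average.\<close>
  obtain K0 where K0: "real K0 > real p / e"
    using reals_Archimedean2 by blast
  define K where "K = max 1 K0"
  have K: "K \<ge> 1" "real K \<ge> real K0"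
    by (auto simp: K_def)
  have "real p / e \<le> real K"
    using K0 K by linarith
  then have pK: "real p / real K \<le> e"
    using K(1) \<open>e > 0\<close> by (simp add: field_simps)
  let ?d = "\<lambda>n. of_bool (a n \<noteq> u n) :: real"
  have pw: "\<bar>(\<Sum>m<K. of_bool (a (n + m))) / real K - c\<bar> \<le> (\<Sum>m<K. ?d (n + m)) / real K + 2 * e" for n
  proof -
    have "\<bar>(\<Sum>m<K. of_bool (a (n + m))) - (\<Sum>m<K. of_bool (u (n + m)) :: real)\<bar> \<le> (\<Sum>m<K. ?d (n + m))"
      unfolding sum_subtractf[symmetric] by (rule order_trans[OF sum_abs sum_mono]) auto
    moreover have "\<bar>(\<Sum>m<K. of_bool (u (n + m))) - real K * ?m\<bar> \<le> real p"
      by (rule periodic_sum_mean[OF p]) (auto simp: u)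
    ultimately have *: "\<bar>(\<Sum>m<K. of_bool (a (n + m))) - real K * ?m\<bar> \<le> (\<Sum>m<K. ?d (n + m)) + real p"
      by linarith
    have "(\<Sum>m<K. of_bool (a (n + m))) / real K - ?m
        = ((\<Sum>m<K. of_bool (a (n + m))) - real K * ?m) / real K"
      using K(1) by (simp add: diff_divide_distrib)
    then have "\<bar>(\<Sum>m<K. of_bool (a (n + m))) / real K - ?m\<bar>
        = \<bar>(\<Sum>m<K. of_bool (a (n + m))) - real K * ?m\<bar> / real K"
      by simp
    also have "\<dots> \<le> ((\<Sum>m<K. ?d (n + m)) + real p) / real K"
      using * by (intro divide_right_mono) auto
    finally show ?thesis
      using cm pK unfolding add_divide_distrib by linarith
  qed
  have "(\<Sum>n<N. \<bar>(\<Sum>m<K. of_bool (a (n + m))) / real K - c\<bar>) \<le> \<epsilon> * real N + (e * real K + \<bar>C\<bar>)" for N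
  proof -
    have "(\<Sum>n<N. ?d (n + m)) \<le> e * real (K + N) + \<bar>C\<bar>" if "m < K" for m
    proof -
      have "(\<Sum>n<N. ?d (n + m)) \<le> (\<Sum>n<m + N. ?d n)"
        by (rule sum_shift_le) simp
      also have "\<dots> \<le> e * real (m + N) + C"
        by (rule dev)
      also have "\<dots> \<le> e * real (K + N) + \<bar>C\<bar>"
        using that \<open>e > 0\<close> by (intro add_mono mult_left_mono) auto
      finally show ?thesis .
    qed
    then have "(\<Sum>m<K. \<Sum>n<N. ?d (n + m)) \<le> (\<Sum>m<K. e * real (K + N) + \<bar>C\<bar>)"
      by (intro sum_mono) auto
    then have le: "(\<Sum>m<K. \<Sum>n<N. ?d (n + m)) / real K \<le> e * real (K + N) + \<bar>C\<bar>"
      using K(1) by (simp add: field_simps)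
    have "(\<Sum>n<N. \<bar>(\<Sum>m<K. of_bool (a (n + m))) / real K - c\<bar>)
        \<le> (\<Sum>n<N. (\<Sum>m<K. ?d (n + m)) / real K + 2 * e)"
      by (intro sum_mono pw)
    also have "\<dots> = (\<Sum>m<K. \<Sum>n<N. ?d (n + m)) / real K + 2 * e * real N"
      by (subst sum.swap) (simp add: sum.distrib sum_divide_distrib)
    also have "\<dots> \<le> e * real (K + N) + \<bar>C\<bar> + 2 * e * real N"
      using le by simp
    also have "\<dots> = \<epsilon> * real N + (e * real K + \<bar>C\<bar>)"
      by (simp add: e_def field_simps)
    finally show ?thesis .
  qed
  then show thesis
    using K(1) that by blast
qed

section \<open>Rationally almost periodic sequences\<close>

text \<open>
  A negative shift \<open>i\<close> produces at most \<open>L\<close> negative positions, whose truth values are not controlled;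
  these are the summand \<open>L\<close>. A positive shift moves the range of summation up by at most \<open>L\<close>.
\<close>

lemma count_shifted_window_le:
  fixes P :: "int \<Rightarrow> bool"
  assumes "\<bar>i\<bar> \<le> int L"
  shows "(\<Sum>n<N. of_bool (P (int n + i))) \<le> real L + (\<Sum>n<L + N. of_bool (P (int n)))"
proof (cases "i \<ge> 0")
  case True
  define k where "k = nat i"
  have k: "i = int k" "k \<le> L"
    using True assms by (auto simp: k_def)
  have "(\<Sum>n<N. of_bool (P (int (n + k))) :: real) \<le> (\<Sum>n<k + N. of_bool (P (int n)))"
    by (rule sum_shift_le) simp
  also have "\<dots> \<le> (\<Sum>n<L + N. of_bool (P (int n)))"
    using k by (intro sum_mono2) auto
  finally show ?thesis
    by (simp add: k)
next
  case False
  define k where "k = nat (- i)"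
  have k: "i = - int k" "k \<le> L"
    using False assms by (auto simp: k_def)
  let ?f = "\<lambda>n. of_bool (P (int n - int k)) :: real"
  have "(\<Sum>n<N. ?f n) \<le> (\<Sum>n<k + N. ?f n)"
    by (intro sum_mono2) auto
  also have "\<dots> = (\<Sum>n<k. ?f n) + (\<Sum>n<N. of_bool (P (int n)))"
    unfolding sum_lessThan_split by simp
  also have "(\<Sum>n<k. ?f n) \<le> real k"
    using sum_bounded_above[of "{..<k}" ?f 1] by auto
  also have "(\<Sum>n<N. of_bool (P (int n)) :: real) \<le> (\<Sum>n<L + N. of_bool (P (int n)))"
    by (intro sum_mono2) auto
  finally show ?thesis
    using k by simp
qed

lemma besicovitch_dist_count_bound:
  assumes dist: "besicovitch_dist \<eta> y < ereal \<epsilon>" and "\<epsilon> > 0"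
    and z: "\<And>n. n \<ge> 1 \<Longrightarrow> z (int n) = \<eta> n" and w: "\<And>n. n \<ge> 1 \<Longrightarrow> w (int n) = y n"
  obtains C where "\<And>N. (\<Sum>n<N. of_bool (z (int n) \<noteq> w (int n))) \<le> \<epsilon> * real N + C"
proof -
  let ?E = "\<lambda>N. {n. 1 \<le> n \<and> n \<le> N \<and> \<eta> n \<noteq> y n}"
  have "\<forall>\<^sub>F N in sequentially. ereal (real (card (?E N)) / real N) < ereal \<epsilon>"
    using dist unfolding besicovitch_dist_def by (rule Limsup_lessD)
  then obtain N0 where N0: "\<And>N. N \<ge> N0 \<Longrightarrow> real (card (?E N)) / real N < \<epsilon>"
    by (auto simp: eventually_sequentially)
  have E: "real (card (?E N)) \<le> \<epsilon> * real N + real N0" for N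
  proof (cases "N \<ge> max 1 N0")
    case True
    then have "real (card (?E N)) < \<epsilon> * real N"
      using N0[of N] by (simp add: pos_divide_less_eq)
    then show ?thesis by simp
  next
    case False
    have "card (?E N) \<le> card {1..N}"
      by (intro card_mono) auto
    then have "real (card (?E N)) \<le> real N0"
      using False by (simp only: card_atLeastAtMost of_nat_le_iff)
    then show ?thesis
      using \<open>\<epsilon> > 0\<close> by (simp add: add_increasing)
  qed
  have "(\<Sum>n<N. of_bool (z (int n) \<noteq> w (int n))) \<le> \<epsilon> * real N + (real N0 + 1)" for N
  proof -
    have "(\<Sum>n<N. of_bool (z (int n) \<noteq> w (int n))) = real (card ({..<N} \<inter> {n. z (int n) \<noteq> w (int n)}))"
      by (simp add: sum_of_bool_eq)
    also have "\<dots> \<le> real (card (insert 0 (?E N)))"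
      using z w by (intro of_nat_mono card_mono) (auto simp: Suc_le_eq)
    also have "\<dots> \<le> real (card (?E N)) + 1"
      using card_insert_le_m1[of "Suc (card (?E N))" "?E N" 0] by simp
    finally show ?thesis
      using E[of N] by simp
  qed
  then show thesis ..
qed

text \<open>
  If \<open>z\<close> and the periodic sequence \<open>w\<close> lie on different sides of \<open>A\<close> after \<open>n\<close> shifts, they differ at one
  of the \<open>2 * L + 1\<close> positions of the window around \<open>n\<close>. So the density of such \<open>n\<close> is at most
  \<open>2 * L + 1\<close> times the distance of \<open>\<eta>\<close> and \<open>y\<close>, which explains the choice of \<open>e\<close>.
\<close>

lemma rationally_almost_periodic_cylinder:
  assumes rap: "rationally_almost_periodic \<eta>"
    and z: "\<And>n. n \<ge> 1 \<Longrightarrow> z (int n) = \<eta> n" and A: "A \<in> cylinders"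
  shows "mean_almost_periodic (\<lambda>n. (left_shift ^^ n) z \<in> A)"
  unfolding mean_almost_periodic_def
proof (intro allI impI)
  fix \<epsilon> :: real assume "\<epsilon> > 0"
  obtain L where L: "\<And>x y. agree L x y \<Longrightarrow> x \<in> A \<longleftrightarrow> y \<in> A"
    using A unfolding cylinders_iff finitely_determined_def by metis
  define e where "e = \<epsilon> / real (2 * L + 1)"
  have "e > 0"
    using \<open>\<epsilon> > 0\<close> by (simp add: e_def)
  obtain y p where y: "besicovitch_dist \<eta> y < ereal e" and p: "p \<ge> 1"
    and per: "\<And>n. n \<ge> 1 \<Longrightarrow> y (n + p) = y n"
    using rap \<open>e > 0\<close> unfolding rationally_almost_periodic_def periodic_seq_def by metis
  have per': "y (n + p * k) = y n" if "n \<ge> 1" for n k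
  proof (induction k)
    case (Suc k)
    then show ?case
      using per[of "n + p * k"] that by (simp add: ac_simps)
  qed simp
  \<comment> \<open>The two-sided periodic extension of \<open>y\<close>. Adding \<open>p\<close> keeps the argument positive: periodicity
    says nothing about the value of \<open>y\<close> at \<open>0\<close>.\<close>
  define w where "w i = y (nat (i mod int p) + p)" for i
  have w: "w (int n) = y n" if "n \<ge> 1" for n
  proof -
    have "w (int n) = y (n mod p + p)"
      by (simp add: w_def flip: zmod_int)
    also have "\<dots> = y (n mod p + p + p * (n div p))"
      using p by (subst per') auto
    also have "n mod p + p + p * (n div p) = n + p"
      using mod_mult_div_eq[of n p] by simp
    also have "y (n + p) = y n"
      using that by (rule per)
    finally show ?thesis .
  qed
  define u where "u n \<longleftrightarrow> (left_shift ^^ n) w \<in> A" for n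
  have "w (i + int p) = w i" for i
    by (simp add: w_def)
  then have "(left_shift ^^ (n + p)) w = (left_shift ^^ n) w" for n
    by (intro ext) (simp add: funpow_left_shift flip: add.assoc)
  then have u: "u (n + p) = u n" for n
    by (simp add: u_def)
  obtain C where C: "\<And>N. (\<Sum>n<N. of_bool (z (int n) \<noteq> w (int n))) \<le> e * real N + C"
    by (rule besicovitch_dist_count_bound[OF y \<open>e > 0\<close> z w]) (assumption | rule that)+
  let ?P = "\<lambda>i. z i \<noteq> w i"
  have "(\<Sum>n<N. of_bool (((left_shift ^^ n) z \<in> A) \<noteq> u n))
      \<le> \<epsilon> * real N + real (2 * L + 1) * (real L + e * real L + C)" for N
  proof -
    have "of_bool (((left_shift ^^ n) z \<in> A) \<noteq> u n)
        \<le> (\<Sum>i\<in>{- int L..int L}. of_bool (?P (int n + i)) :: real)" for n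
    proof (cases "((left_shift ^^ n) z \<in> A) = u n")
      case False
      then have "\<not> agree L ((left_shift ^^ n) z) ((left_shift ^^ n) w)"
        using L unfolding u_def by blast
      then obtain i where i: "\<bar>i\<bar> \<le> int L" "?P (int n + i)"
        by (auto simp: agree_def funpow_left_shift add.commute)
      then have "(1::real) \<le> of_bool (?P (int n + i))"
        by simp
      also have "\<dots> \<le> (\<Sum>i\<in>{- int L..int L}. of_bool (?P (int n + i)))"
        using i by (intro member_le_sum) (auto simp: abs_le_iff)
      finally show ?thesis
        using False by simp
    qed (simp add: sum_nonneg)
    then have "(\<Sum>n<N. of_bool (((left_shift ^^ n) z \<in> A) \<noteq> u n))
        \<le> (\<Sum>n<N. \<Sum>i\<in>{- int L..int L}. of_bool (?P (int n + i)) :: real)"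
      by (intro sum_mono)
    also have "\<dots> = (\<Sum>i\<in>{- int L..int L}. \<Sum>n<N. of_bool (?P (int n + i)))"
      by (rule sum.swap)
    also have "\<dots> \<le> (\<Sum>i\<in>{- int L..int L}. real L + (e * real (L + N) + C))"
      by (intro sum_mono order_trans[OF count_shifted_window_le[where L = L]] add_left_mono C) auto
    also have "\<dots> = real (2 * L + 1) * (real L + (e * real (L + N) + C))"
      by (simp add: nat_add_distrib)
    also have "\<dots> = (real (2 * L + 1) * e) * real N + real (2 * L + 1) * (real L + e * real L + C)"
      by (simp add: algebra_simps)
    also have "real (2 * L + 1) * e = \<epsilon>"
      by (simp add: e_def)
    finally show ?thesis .
  qed
  then show "\<exists>p u C. p \<ge> 1 \<and> (\<forall>n. u (n + p) = u n) \<and>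
      (\<forall>N. (\<Sum>n<N. of_bool (((left_shift ^^ n) z \<in> A) \<noteq> u n)) \<le> \<epsilon> * real N + C)"
    using p u by blast
qed

section \<open>The measure of a sequence with frequencies\<close>

definition has_frequencies :: "(int \<Rightarrow> 'a) \<Rightarrow> (int \<Rightarrow> 'a) measure \<Rightarrow> bool" where
  "has_frequencies z \<nu> \<longleftrightarrow> (\<forall>A\<in>cylinders.
     (\<lambda>N. (\<Sum>n<N. of_bool ((left_shift ^^ n) z \<in> A)) / real N) \<longlonglongrightarrow> measure \<nu> A)"

text \<open>
  Frequencies are finitely additive on the cylinder sets because limits are additive. Countable
  additivity costs nothing, since a decreasing sequence of cylinder sets with empty intersection
  becomes empty.
\<close>

lemma frequency_measure_exists:
  fixes z :: "int \<Rightarrow> 'a :: {finite, discrete_topology}"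
  assumes conv: "\<And>A. A \<in> cylinders \<Longrightarrow>
    convergent (\<lambda>N. (\<Sum>n<N. of_bool ((left_shift ^^ n) z \<in> A)) / real N)"
  obtains \<nu> where "prob_space \<nu>" "sets \<nu> = sets borel" "has_frequencies z \<nu>"
proof -
  define q where "q A N = (\<Sum>n<N. of_bool ((left_shift ^^ n) z \<in> A)) / real N" for A N
  define F where "F A = lim (q A)" for A
  have F: "q A \<longlonglongrightarrow> F A" if "A \<in> cylinders" for A
    using conv[OF that] unfolding F_def q_def by (simp add: convergent_LIMSEQ_iff)
  have F_nonneg: "F A \<ge> 0" if "A \<in> cylinders" for A
    by (rule LIMSEQ_le_const[OF F[OF that]]) (auto simp: q_def intro!: divide_nonneg_nonneg sum_nonneg)
  have F_UNIV: "F UNIV = 1"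
  proof (rule LIMSEQ_unique[OF F[OF cylinders_UNIV]])
    have "\<forall>\<^sub>F N in sequentially. q UNIV N = 1"
      using eventually_gt_at_top[of 0] by eventually_elim (simp add: q_def)
    then show "q UNIV \<longlonglongrightarrow> 1"
      by (rule tendsto_eventually)
  qed
  have F_empty: "F {} = 0"
    by (rule LIMSEQ_unique[OF F[OF cylinders_empty]]) (simp add: q_def[abs_def])
  have F_add: "F (A \<union> B) = F A + F B" if "A \<in> cylinders" "B \<in> cylinders" "A \<inter> B = {}" for A B
  proof (rule LIMSEQ_unique[OF F[OF cylinders_Un[OF that(1,2)]]])
    have "q (A \<union> B) N = q A N + q B N" for N
    proof -
      have "of_bool (x \<in> A \<union> B) = (of_bool (x \<in> A) + of_bool (x \<in> B) :: real)" for x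
        using that(3) by auto
      then show ?thesis
        by (simp only: q_def sum.distrib add_divide_distrib)
    qed
    then have "q (A \<union> B) = (\<lambda>N. q A N + q B N)"
      by (rule ext)
    then show "q (A \<union> B) \<longlonglongrightarrow> F A + F B"
      using tendsto_add[OF F[OF that(1)] F[OF that(2)]] by simp
  qed
  interpret ring_of_sets "UNIV :: (int \<Rightarrow> 'a) set" cylinders
    by (simp add: ring_of_sets_iff cylinders_empty cylinders_Un cylinders_Diff)
  have "\<exists>\<mu> :: (int \<Rightarrow> 'a) set \<Rightarrow> ennreal. (\<forall>s\<in>cylinders. \<mu> s = ennreal (F s)) \<and>
      measure_space UNIV (sigma_sets UNIV cylinders) \<mu>"
  proof (rule caratheodory_empty_continuous)
    show "positive cylinders (\<lambda>A. ennreal (F A))"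
      by (simp add: positive_def F_empty)
    show "additive cylinders (\<lambda>A. ennreal (F A))"
      by (auto simp: additive_def F_add F_nonneg ennreal_plus[symmetric] simp del: ennreal_plus)
    fix A :: "nat \<Rightarrow> (int \<Rightarrow> 'a) set"
    assume A: "range A \<subseteq> cylinders" and dec: "decseq A" and empty: "(\<Inter>i. A i) = {}"
    then obtain n where n: "A n = {}"
      by (metis decseq_cylinders_empty range_subsetD)
    have "\<forall>\<^sub>F i in sequentially. ennreal (F (A i)) = 0"
      using eventually_ge_at_top[of n]
    proof eventually_elim
      case (elim i)
      then have "A i = {}"
        using decseqD[OF dec] n by blast
      then show ?case
        by (simp add: F_empty)
    qed
    then show "(\<lambda>i. ennreal (F (A i))) \<longlonglongrightarrow> 0"
      by (rule tendsto_eventually)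
  qed simp
  then obtain \<mu> where \<mu>: "\<And>A. A \<in> cylinders \<Longrightarrow> \<mu> A = ennreal (F A)"
    and space: "measure_space UNIV (sigma_sets UNIV (cylinders :: (int \<Rightarrow> 'a) set set)) \<mu>"
    by blast
  define \<nu> where "\<nu> = measure_of UNIV (sigma_sets UNIV cylinders) \<mu>"
  have sets_\<nu>: "sets \<nu> = sigma_sets UNIV cylinders"
    using space unfolding \<nu>_def measure_space_def by (intro sigma_algebra.sets_measure_of_eq) simp
  have space_\<nu>: "space \<nu> = UNIV"
    by (simp add: \<nu>_def space_measure_of_conv)
  have emeasure_\<nu>: "emeasure \<nu> A = ennreal (F A)" if "A \<in> cylinders" for A
    using space that unfolding \<nu>_def measure_space_def
    by (subst emeasure_measure_of_sigma) (auto simp: \<mu>)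
  show thesis
  proof (rule that)
    show "sets \<nu> = sets borel"
      by (simp add: sets_\<nu> sets_borel_cylinders)
    show "prob_space \<nu>"
      by (rule prob_spaceI) (simp add: space_\<nu> emeasure_\<nu> cylinders_UNIV F_UNIV)
    show "has_frequencies z \<nu>"
      using F emeasure_\<nu> F_nonneg unfolding has_frequencies_def q_def by (simp add: measure_def)
  qed
qed

text \<open>
  Once the window around \<open>n\<close> has moved to positive positions, both orbits visit a cylinder set at the
  same times. So the frequencies do not depend on the left half of the sequence.
\<close>

lemma has_frequencies_cong:
  assumes freq: "has_frequencies z \<nu>" and eq: "\<And>n. n \<ge> 1 \<Longrightarrow> z (int n) = w (int n)"
  shows "has_frequencies w \<nu>"
  unfolding has_frequencies_def
proof
  fix A :: "(int \<Rightarrow> 'a) set" assume A: "A \<in> cylinders"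
  then obtain L where L: "\<And>x y. agree L x y \<Longrightarrow> x \<in> A \<longleftrightarrow> y \<in> A"
    unfolding cylinders_iff finitely_determined_def by metis
  let ?a = "\<lambda>x n. of_bool ((left_shift ^^ n) x \<in> A) :: real"
  have same: "?a z n = ?a w n" if "n > L" for n
  proof -
    have "z (i + int n) = w (i + int n)" if "\<bar>i\<bar> \<le> int L" for i
    proof -
      have "i + int n = int (nat (i + int n))" "nat (i + int n) \<ge> 1"
        using that \<open>n > L\<close> by auto
      then show ?thesis
        using eq by metis
    qed
    then have "agree L ((left_shift ^^ n) z) ((left_shift ^^ n) w)"
      by (simp add: agree_def funpow_left_shift)
    then show ?thesis
      using L by simp
  qed
  have "\<bar>(\<Sum>n<N. ?a z n) - (\<Sum>n<N. ?a w n)\<bar> \<le> real (Suc L)" for N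
  proof -
    have "\<bar>(\<Sum>n<N. ?a z n) - (\<Sum>n<N. ?a w n)\<bar> \<le> (\<Sum>n<N. of_bool (n < Suc L))"
      unfolding sum_subtractf[symmetric]
      by (rule order_trans[OF sum_abs sum_mono]) (use same in \<open>auto simp: less_Suc_eq_le not_le\<close>)
    also have "\<dots> = real (card ({..<N} \<inter> {n. n < Suc L}))"
      by (simp add: sum_of_bool_eq)
    also have "\<dots> \<le> real (card {..<Suc L})"
      by (intro of_nat_mono card_mono) auto
    finally show ?thesis by simp
  qed
  moreover have "(\<lambda>N. (\<Sum>n<N. ?a z n) / real N) \<longlonglongrightarrow> measure \<nu> A"
    using freq A by (simp add: has_frequencies_def)
  ultimately show "(\<lambda>N. (\<Sum>n<N. ?a w n) / real N) \<longlonglongrightarrow> measure \<nu> A"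
    by (rule average_limit_cong[rotated])
qed

context
  fixes z :: "int \<Rightarrow> 'a :: {finite, discrete_topology}" and \<nu>
  assumes freq: "has_frequencies z \<nu>" and prob: "prob_space \<nu>" and sets_nu: "sets \<nu> = sets borel"
begin

interpretation prob_space \<nu>
  by (rule prob)

lemma space_nu: "space \<nu> = UNIV"
  using sets_eq_imp_space_eq[OF sets_nu] by simp

lemma cylinders_nu: "A \<in> cylinders \<Longrightarrow> A \<in> sets \<nu>"
  by (simp add: sets_nu cylinders_borel)

lemma frequency:
  "A \<in> cylinders \<Longrightarrow> (\<lambda>N. (\<Sum>n<N. of_bool ((left_shift ^^ n) z \<in> A)) / real N) \<longlonglongrightarrow> measure \<nu> A"
  using freq by (simp add: has_frequencies_def)

text \<open>
  A function of finitely many coordinates over a finite alphabet takes finitely many values, and its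
  level sets are cylinder sets. Averages along the orbit and integrals are then the same combination
  of frequencies and of measures.
\<close>

lemma finitely_determined_average:
  fixes g :: "(int \<Rightarrow> 'a) \<Rightarrow> 'b :: {banach, second_countable_topology}"
  assumes g: "finitely_determined g"
  shows "(\<lambda>N. (\<Sum>n<N. g ((left_shift ^^ n) z)) /\<^sub>R real N) \<longlonglongrightarrow> (LINT x|\<nu>. g x)"
proof -
  let ?B = "\<lambda>v. g -` {v}"
  note fin = finitely_determined_finite_range[OF g]
  have B: "?B v \<in> cylinders" for v
    by (rule finitely_determined_level_set[OF g])
  have g_eq: "g x = (\<Sum>v\<in>range g. of_bool (x \<in> ?B v) *\<^sub>R v)" for x
  proof -
    have "(\<Sum>v\<in>range g. of_bool (x \<in> ?B v) *\<^sub>R v) = (\<Sum>v\<in>range g. if v = g x then g x else 0)"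
      by (intro sum.cong) auto
    then show ?thesis
      using fin by simp
  qed
  have "(\<Sum>n<N. g ((left_shift ^^ n) z)) /\<^sub>R real N
      = (\<Sum>v\<in>range g. ((\<Sum>n<N. of_bool ((left_shift ^^ n) z \<in> ?B v)) / real N) *\<^sub>R v)" for N
  proof -
    have "(\<Sum>n<N. g ((left_shift ^^ n) z))
        = (\<Sum>n<N. \<Sum>v\<in>range g. of_bool ((left_shift ^^ n) z \<in> ?B v) *\<^sub>R v)"
      by (intro sum.cong refl g_eq)
    also have "\<dots> = (\<Sum>v\<in>range g. (\<Sum>n<N. of_bool ((left_shift ^^ n) z \<in> ?B v)) *\<^sub>R v)"
      unfolding scaleR_left.sum by (rule sum.swap)
    finally show ?thesis
      by (simp add: scaleR_sum_right divide_inverse mult.commute)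
  qed
  moreover have "(\<lambda>N. \<Sum>v\<in>range g. ((\<Sum>n<N. of_bool ((left_shift ^^ n) z \<in> ?B v)) / real N) *\<^sub>R v)
      \<longlonglongrightarrow> (\<Sum>v\<in>range g. measure \<nu> (?B v) *\<^sub>R v)"
    by (intro tendsto_sum tendsto_scaleR tendsto_const frequency B)
  moreover have "(LINT x|\<nu>. g x) = (\<Sum>v\<in>range g. measure \<nu> (?B v) *\<^sub>R v)"
  proof -
    have "(LINT x|\<nu>. g x) = (LINT x|\<nu>. (\<Sum>v\<in>range g. indicat_real (?B v) x *\<^sub>R v))"
      using g_eq by (intro Bochner_Integration.integral_cong) (auto simp: indicator_def of_bool_def)
    also have "\<dots> = (\<Sum>v\<in>range g. LINT x|\<nu>. indicat_real (?B v) x *\<^sub>R v)"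
      using cylinders_nu[OF B] by (intro Bochner_Integration.integral_sum integrable_scaleR_left)
        (auto simp: less_top[symmetric])
    also have "\<dots> = (\<Sum>v\<in>range g. measure \<nu> (?B v) *\<^sub>R v)"
      using cylinders_nu[OF B] by (simp add: space_nu less_top[symmetric])
    finally show ?thesis .
  qed
  ultimately show ?thesis
    by simp
qed

lemma continuous_average:
  fixes f :: "(int \<Rightarrow> 'a) \<Rightarrow> complex"
  assumes f: "continuous_on UNIV f"
  shows "(\<lambda>N. (\<Sum>n<N. f ((left_shift ^^ n) z)) / of_nat N) \<longlonglongrightarrow> (LINT x|\<nu>. f x)"
proof (rule LIMSEQ_I)
  fix e :: real assume "e > 0"
  then have "e / 3 > 0" by simp
  obtain g where g: "finitely_determined g" and fg: "\<And>x. norm (f x - g x) < e / 3"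
    using continuous_finitely_determined_approximation[OF f \<open>e / 3 > 0\<close>] by blast
  let ?F = "\<lambda>N. (\<Sum>n<N. f ((left_shift ^^ n) z)) / of_nat N"
  let ?G = "\<lambda>N. (\<Sum>n<N. g ((left_shift ^^ n) z)) / of_nat N"
  have "(\<lambda>N. (\<Sum>n<N. g ((left_shift ^^ n) z)) /\<^sub>R real N) \<longlonglongrightarrow> (LINT x|\<nu>. g x)"
    by (rule finitely_determined_average[OF g])
  then have "?G \<longlonglongrightarrow> (LINT x|\<nu>. g x)"
    by (simp add: scaleR_conv_of_real divide_inverse mult.commute)
  then obtain N0 where N0: "\<And>N. N \<ge> N0 \<Longrightarrow> norm (?G N - (LINT x|\<nu>. g x)) < e / 3"
    using \<open>e / 3 > 0\<close> by (meson LIMSEQ_D)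
  have g_meas: "g \<in> borel_measurable \<nu>"
    using finitely_determined_measurable[OF g, of borel] by (simp add: measurable_cong_sets[OF sets_nu refl])
  have f_meas: "f \<in> borel_measurable \<nu>"
    using borel_measurable_continuous_onI[OF f] by (simp add: measurable_cong_sets[OF sets_nu refl])
  obtain K where K: "\<And>x. norm (g x) \<le> K"
    using finite_imp_bounded[OF finitely_determined_finite_range[OF g]] by (auto simp: bounded_iff)
  have g_int: "integrable \<nu> g"
    using K g_meas by (intro integrable_const_bound[of _ K]) auto
  have f_int: "integrable \<nu> f"
  proof (rule integrable_const_bound[OF _ f_meas])
    have "norm (f x) \<le> K + e / 3" for x
      using norm_triangle_ineq2[of "f x" "g x"] fg[of x] K[of x] by linarith
    then show "AE x in \<nu>. norm (f x) \<le> K + e / 3"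
      by simp
  qed
  have int: "norm ((LINT x|\<nu>. g x) - (LINT x|\<nu>. f x)) \<le> e / 3"
  proof -
    have "norm ((LINT x|\<nu>. g x) - (LINT x|\<nu>. f x)) = norm (LINT x|\<nu>. g x - f x)"
      by (simp add: f_int g_int)
    also have "\<dots> \<le> (LINT x|\<nu>. norm (g x - f x))"
      by (rule integral_norm_bound)
    also have "\<dots> \<le> (LINT x|\<nu>. e / 3)"
      using fg by (intro integral_mono integrable_norm Bochner_Integration.integrable_diff f_int g_int)
        (auto simp: norm_minus_commute less_imp_le)
    finally show ?thesis
      by (simp add: prob_space)
  qed
  have avg: "norm (?F N - ?G N) \<le> e / 3" if "N \<ge> 1" for N
  proof -
    have "norm (\<Sum>n<N. f ((left_shift ^^ n) z) - g ((left_shift ^^ n) z)) \<le> (\<Sum>n<N. e / 3)"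
      by (rule order_trans[OF norm_sum sum_mono]) (use fg in \<open>auto intro: less_imp_le\<close>)
    moreover have "norm (?F N - ?G N)
        = norm (\<Sum>n<N. f ((left_shift ^^ n) z) - g ((left_shift ^^ n) z)) / real N"
      by (simp add: sum_subtractf norm_divide flip: diff_divide_distrib)
    ultimately show ?thesis
      using that by (simp add: pos_divide_le_eq mult.commute)
  qed
  have "norm (?F N - (LINT x|\<nu>. f x)) < e" if "N \<ge> max 1 N0" for N
  proof -
    have "norm (?F N - (LINT x|\<nu>. f x))
        \<le> norm (?F N - ?G N) + norm (?G N - (LINT x|\<nu>. g x)) + norm ((LINT x|\<nu>. g x) - (LINT x|\<nu>. f x))"
      using norm_triangle_ineq[of "(?F N - ?G N) + (?G N - (LINT x|\<nu>. g x))" "(LINT x|\<nu>. g x) - (LINT x|\<nu>. f x)"]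
        norm_triangle_ineq[of "?F N - ?G N" "?G N - (LINT x|\<nu>. g x)"]
      by (simp only: diff_add_cancel add_diff_eq)
    then show ?thesis
      using N0[of N] avg[of N] int that by simp
  qed
  then show "\<exists>N0. \<forall>N\<ge>N0. norm (?F N - (LINT x|\<nu>. f x)) < e"
    by blast
qed

text \<open>
  The numbers of visits to a set and to its preimage under the shift differ by at most one, so their
  frequencies agree.
\<close>

lemma frequency_measure_invariant:
  "distr \<nu> \<nu> left_shift = \<nu>"
proof (rule measure_eqI_generator_eq[OF Int_stable_cylinders, where A = "\<lambda>_. UNIV"])
  have meas: "left_shift \<in> measurable \<nu> \<nu>"
    using left_shift_measurable by (simp add: measurable_cong_sets[OF sets_nu sets_nu])
  then show "emeasure (distr \<nu> \<nu> left_shift) UNIV \<noteq> \<infinity>"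
    by (subst emeasure_distr) (simp_all add: sets_nu emeasure_eq_measure)
  fix A :: "(int \<Rightarrow> 'a) set" assume A: "A \<in> cylinders"
  let ?a = "\<lambda>n. of_bool ((left_shift ^^ n) z \<in> A) :: real"
  have "(\<lambda>N. (\<Sum>n<N. of_bool ((left_shift ^^ n) z \<in> left_shift -` A)) / real N) \<longlonglongrightarrow> measure \<nu> A"
  proof (rule average_limit_cong[OF frequency[OF A]])
    fix N
    have "(\<Sum>n<N. ?a (Suc n)) - (\<Sum>n<N. ?a n) = ?a N - ?a 0"
      unfolding sum_subtractf[symmetric] by (rule sum_lessThan_telescope)
    moreover have "\<bar>?a N - ?a 0\<bar> \<le> 1"
      by simp
    moreover have "(\<Sum>n<N. of_bool ((left_shift ^^ n) z \<in> left_shift -` A)) = (\<Sum>n<N. ?a (Suc n))"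
      by (intro sum.cong) simp_all
    ultimately show "\<bar>(\<Sum>n<N. ?a n) - (\<Sum>n<N. of_bool ((left_shift ^^ n) z \<in> left_shift -` A))\<bar> \<le> 1"
      by linarith
  qed
  moreover have "left_shift -` A \<in> cylinders"
    using cylinders_shift[OF A, of 1] by simp
  note frequency[OF this]
  ultimately have "measure \<nu> (left_shift -` A) = measure \<nu> A"
    using LIMSEQ_unique by blast
  then show "emeasure (distr \<nu> \<nu> left_shift) A = emeasure \<nu> A"
    using cylinders_nu[OF A] meas by (simp add: emeasure_distr space_nu emeasure_eq_measure)
qed (auto simp: sets_nu sets_borel_cylinders cylinders_UNIV)

lemma frequency_zero:
  assumes "A \<in> cylinders" "\<And>n. n \<ge> K \<Longrightarrow> (left_shift ^^ n) z \<notin> A"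
  shows "A \<in> null_sets \<nu>"
proof -
  let ?a = "\<lambda>n. of_bool ((left_shift ^^ n) z \<in> A) :: real"
  have "\<bar>0 - (\<Sum>n<N. ?a n)\<bar> \<le> real K" for N
  proof -
    have "(\<Sum>n<N. ?a n) = real (card ({..<N} \<inter> {n. (left_shift ^^ n) z \<in> A}))"
      by (simp add: sum_of_bool_eq)
    also have "\<dots> \<le> real (card {..<K})"
      using assms(2) by (intro of_nat_mono card_mono) (auto simp: not_le[symmetric])
    finally show ?thesis
      by (simp add: sum_nonneg)
  qed
  then have "(\<lambda>N. (\<Sum>n<N. ?a n) / real N) \<longlonglongrightarrow> 0"
    by (rule average_limit_cong[of "\<lambda>_. 0" 0, rotated]) simp
  with frequency[OF assms(1)] have "measure \<nu> A = 0"
    by (rule LIMSEQ_unique)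
  then show ?thesis
    using cylinders_nu[OF assms(1)] by (auto simp: null_sets_def emeasure_eq_measure)
qed

end

section \<open>The subshift\<close>

lemma map_shift_upto: "map (\<lambda>i. x (i + k)) [n..m] = map x [n + k..m + k]" for k :: int
  by (rule nth_equalityI) (auto simp: nth_upto ac_simps)

lemma left_shift_subshift: "x \<in> subshift \<eta> \<Longrightarrow> left_shift x \<in> subshift \<eta>"
proof -
  assume x: "x \<in> subshift \<eta>"
  have "map (left_shift x) [n..m] \<in> words_Z x" if "n \<le> m" for n m
    using that map_shift_upto[of x 1 n m] unfolding left_shift_def words_Z_def by force
  then show ?thesis
    using x by (auto simp: subshift_def words_Z_def)
qed

lemma orbit_word_in_words_N:
  assumes z: "\<And>n. n \<ge> 1 \<Longrightarrow> z (int n) = \<eta> n" and "n \<le> m" "n + int k \<ge> 1"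
  shows "map ((left_shift ^^ k) z) [n..m] \<in> words_N \<eta>"
proof -
  have "map ((left_shift ^^ k) z) [n..m] = map \<eta> [nat (n + int k)..<Suc (nat (m + int k))]"
  proof (rule nth_equalityI)
    fix j assume "j < length (map ((left_shift ^^ k) z) [n..m])"
    then have j: "n + int j \<le> m"
      by simp
    have "n + int j + int k = int (nat (n + int k) + j)" "nat (n + int k) + j \<ge> 1"
      using assms(3) by auto
    then have "z (n + int j + int k) = \<eta> (nat (n + int k) + j)"
      using z by metis
    then show "map ((left_shift ^^ k) z) [n..m] ! j
        = map \<eta> [nat (n + int k)..<Suc (nat (m + int k))] ! j"
      using j assms(3) by (simp add: nth_upto funpow_left_shift del: upt_Suc)
  qed (use assms(2,3) in auto)
  moreover have "1 \<le> nat (n + int k)" "nat (n + int k) \<le> nat (m + int k)"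
    using assms(2,3) by auto
  ultimately show ?thesis
    unfolding words_N_def by blast
qed

text \<open>
  The complement of the subshift is the countable union of the cylinder sets \<open>D n m\<close> of sequences that
  show a forbidden word at the positions from \<open>n\<close> to \<open>m\<close>. The orbit of \<open>z\<close> visits \<open>D n m\<close> only while
  these positions are still partly nonpositive.
\<close>

lemma AE_subshift:
  fixes z :: "int \<Rightarrow> 'a :: {finite, discrete_topology}"
  assumes z: "\<And>n. n \<ge> 1 \<Longrightarrow> z (int n) = \<eta> n"
    and nu: "has_frequencies z \<nu>" "prob_space \<nu>" "sets \<nu> = sets borel"
  shows "subshift \<eta> \<in> sets \<nu>" "AE x in \<nu>. x \<in> subshift \<eta>"
proof -
  define D where "D n m = {x :: int \<Rightarrow> 'a. n \<le> m \<and> map x [n..m] \<notin> words_N \<eta>}" for n m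
  have compl: "- subshift \<eta> = (\<Union>p. D (fst p) (snd p))"
    by (auto simp: subshift_def words_Z_def D_def)
  have "D n m \<in> null_sets \<nu>" for n m
  proof (rule frequency_zero[OF nu])
    show "D n m \<in> cylinders"
      unfolding cylinders_iff
    proof (rule finitely_determinedI)
      fix x y :: "int \<Rightarrow> 'a" assume "agree (nat (\<bar>n\<bar> + \<bar>m\<bar>)) x y"
      then have "map x [n..m] = map y [n..m]"
        by (auto simp: agree_def)
      then show "(x \<in> D n m) = (y \<in> D n m)"
        unfolding D_def mem_Collect_eq by (simp only:)
    qed
    show "(left_shift ^^ k) z \<notin> D n m" if "nat \<bar>n\<bar> + 1 \<le> k" for k
      using orbit_word_in_words_N[of z \<eta> n m k] z that by (auto simp: D_def)
  qed
  then have null: "- subshift \<eta> \<in> null_sets \<nu>"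
    unfolding compl by (intro null_sets_UN) auto
  have "space \<nu> = UNIV"
    using sets_eq_imp_space_eq[OF nu(3)] by simp
  then show "subshift \<eta> \<in> sets \<nu>"
    using sets.compl_sets[OF null_setsD2[OF null]] by (simp add: Compl_eq_Diff_UNIV[symmetric])
  show "AE x in \<nu>. x \<in> subshift \<eta>"
    using AE_not_in[OF null] by simp
qed

text \<open>
  The measure \<open>\<mu>\<close> of the frequencies lives on the whole sequence space; \<open>\<nu>\<close> is its restriction to the
  subshift, a set of full measure. Statements about \<open>\<nu>\<close> are reduced to statements about frequencies
  along \<open>z\<close>, where the two averaging lemmas for sequences of truth values apply.
\<close>

theorem theorem1p7:
  fixes \<eta> :: "nat \<Rightarrow> 'a :: {finite, discrete_topology}"
  assumes "rationally_almost_periodic \<eta>"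
  shows "\<exists>\<nu> :: (int \<Rightarrow> 'a) measure.
    sets \<nu> = sets (restrict_space borel (subshift \<eta>)) \<and>
    prob_space \<nu> \<and>
    invariant_measure \<nu> left_shift \<and>
    generic_for \<eta> (distr \<nu> borel (\<lambda>x. x)) \<and>
    ergodic \<nu> left_shift \<and>
    rational_discrete_spectrum \<nu> left_shift"
proof -
  define X where "X = subshift \<eta>"
  \<comment> \<open>Nonpositive positions receive the value at \<open>0\<close>; any two-sided extension would do.\<close>
  define z where "z i = \<eta> (nat i)" for i
  have z: "z (int n) = \<eta> n" for n
    by (simp add: z_def)
  have map_cyl: "mean_almost_periodic (\<lambda>n. (left_shift ^^ n) z \<in> A)" if "A \<in> cylinders" for A
    by (rule rationally_almost_periodic_cylinder[OF assms z that])
  obtain \<mu> where prob: "prob_space \<mu>" and sets_mu: "sets \<mu> = sets borel" and freq: "has_frequencies z \<mu>"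
    by (rule frequency_measure_exists[OF mean_almost_periodic_convergent[OF map_cyl]])
  note mu = freq prob sets_mu
  interpret mu: prob_space \<mu> by (rule prob)
  have space_mu: "space \<mu> = UNIV"
    by (rule space_nu[OF mu])
  have X: "X \<in> sets \<mu>" and AE_X: "AE x in \<mu>. x \<in> X"
    unfolding X_def by (rule AE_subshift[OF z mu])+
  have X_shift: "(left_shift ^^ n) x \<in> X" if "x \<in> X" for n x
    using that left_shift_subshift unfolding X_def by (induction n) auto
  define \<nu> where "\<nu> = restrict_space \<mu> X"
  have space_nu: "space \<nu> = X"
    by (simp add: \<nu>_def space_restrict_space space_mu)
  have sets_nu: "sets \<nu> = sets (restrict_space borel X)"
    unfolding \<nu>_def by (rule sets_restrict_space_cong[OF sets_mu])
  have emeasure_nu: "emeasure \<nu> (A \<inter> X) = emeasure \<mu> A" if "A \<in> sets \<mu>" for A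
  proof -
    have "emeasure \<nu> (A \<inter> X) = emeasure \<mu> (A \<inter> X)"
      unfolding \<nu>_def using X by (intro emeasure_restrict_space) (auto simp: space_mu)
    also have "\<dots> = emeasure \<mu> A"
      using AE_X that X by (intro emeasure_eq_AE) auto
    finally show ?thesis .
  qed
  have integral_nu: "(LINT x|\<nu>. f x) = (LINT x|\<mu>. f x)"
    if f: "f \<in> borel_measurable \<mu>" for f :: "(int \<Rightarrow> 'a) \<Rightarrow> 'b :: {banach, second_countable_topology}"
  proof -
    have "(LINT x|\<nu>. f x) = (LINT x|\<mu>. indicator X x *\<^sub>R f x)"
      unfolding \<nu>_def using X by (intro integral_restrict_space) (simp add: space_mu)
    also have "\<dots> = (LINT x|\<mu>. f x)"
      using AE_X X f by (intro integral_cong_AE) (auto elim: eventually_mono)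
    finally show ?thesis .
  qed
  have shift_mu: "left_shift \<in> measurable \<mu> \<mu>"
    using left_shift_measurable by (simp add: measurable_cong_sets[OF sets_mu sets_mu])
  have shift_nu: "left_shift \<in> measurable \<nu> \<nu>"
    unfolding \<nu>_def using X_shift[of _ 1] by (intro measurable_restrict_space3 shift_mu) auto
  have distr_nu: "distr \<nu> \<nu> left_shift = \<nu>"
  proof (rule measure_eqI)
    fix A assume "A \<in> sets (distr \<nu> \<nu> left_shift)"
    then have A: "A \<in> sets \<nu>" by simp
    then have A': "A \<in> sets \<mu>" "A \<subseteq> X"
      using X unfolding \<nu>_def by (auto simp: sets_restrict_space_iff space_mu)
    have pre: "left_shift -` A \<in> sets \<mu>"
      using measurable_sets[OF shift_mu A'(1)] by (simp add: space_mu)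
    have "emeasure (distr \<nu> \<nu> left_shift) A = emeasure \<nu> (left_shift -` A \<inter> X)"
      using A shift_nu by (simp add: emeasure_distr space_nu)
    also have "\<dots> = emeasure \<mu> (left_shift -` A)"
      by (rule emeasure_nu[OF pre])
    also have "\<dots> = emeasure (distr \<mu> \<mu> left_shift) A"
      using A' shift_mu by (simp add: emeasure_distr space_mu)
    also have "\<dots> = emeasure \<mu> A"
      by (simp add: frequency_measure_invariant[OF mu])
    also have "\<dots> = emeasure \<nu> A"
      using emeasure_nu[OF A'(1)] A'(2) by (simp add: Int_absorb2)
    finally show "emeasure (distr \<nu> \<nu> left_shift) A = emeasure \<nu> A" .
  qed simp
  have prob_nu: "prob_space \<nu>"
    by (rule prob_spaceI) (use emeasure_nu[of UNIV] mu.emeasure_space_1 space_mu in \<open>simp add: space_nu\<close>,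
      metis sets.top)
  interpret nu: prob_space \<nu> by (rule prob_nu)
  interpret measure_preserving_system \<nu> left_shift
    by unfold_locales (rule shift_nu distr_nu)+

  let ?G = "(\<inter>) X ` cylinders"
  have G: "Int_stable ?G" "?G \<subseteq> Pow (space \<nu>)" "sets \<nu> = sigma_sets (space \<nu>) ?G"
  proof -
    show "Int_stable ?G"
    proof (rule Int_stableI)
      fix a b assume "a \<in> ?G" "b \<in> ?G"
      then obtain A B where "A \<in> cylinders" "B \<in> cylinders" "a = X \<inter> A" "b = X \<inter> B"
        by blast
      then have "a \<inter> b = X \<inter> (A \<inter> B)" "A \<inter> B \<in> cylinders"
        by (auto intro: cylinders_Int)
      then show "a \<inter> b \<in> ?G" by blast
    qed
    show "?G \<subseteq> Pow (space \<nu>)"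
      by (auto simp: space_nu)
    show "sets \<nu> = sigma_sets (space \<nu>) ?G"
      using X unfolding \<nu>_def sets_restrict_space space_restrict_space space_mu sets_mu sets_borel_cylinders
      by (simp add: sigma_sets_Int)
  qed
  have cyl_mu: "A \<in> sets \<mu>" if "A \<in> cylinders" for A
    using that by (rule cylinders_nu[OF mu])
  have cyl_nu: "X \<inter> A \<in> sets \<nu>" if "A \<in> cylinders" for A
    unfolding G(3) using that by (intro sigma_sets.Basic) blast

  have "almost_periodic_set (X \<inter> A)" if A: "A \<in> cylinders" for A
    unfolding almost_periodic_set_def
  proof (intro conjI allI impI)
    fix \<epsilon> :: real assume "\<epsilon> > 0"
    obtain p where p: "p \<ge> 1" and per: "\<And>m. \<exists>C. \<forall>N. (\<Sum>n<N. of_bool (((left_shift ^^ (n + p * m)) z \<in> A)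
        \<noteq> ((left_shift ^^ n) z \<in> A))) \<le> \<epsilon> * real N + C"
      by (rule mean_almost_periodic_almost_periods[OF map_cyl[OF A] \<open>\<epsilon> > 0\<close>]) blast
    have "(LINT x|\<nu>. \<bar>indicat_real (X \<inter> A) ((left_shift ^^ (p * m)) x) - indicat_real (X \<inter> A) x\<bar>) \<le> \<epsilon>" for m
    proof -
      \<comment> \<open>The set on which \<open>p * m\<close> fails to be a period of \<open>A\<close> is itself a cylinder set, so its
        measure is the frequency of the failures along \<open>z\<close>.\<close>
      let ?D = "{x. ((left_shift ^^ (p * m)) x \<in> A) \<noteq> (x \<in> A)}"
      have D: "?D \<in> cylinders"
        using A unfolding cylinders_iff mem_Collect_eq
        by (intro finitely_determined_pair[where h = "(\<noteq>)"] finitely_determined_shift)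
      have "(LINT x|\<nu>. \<bar>indicat_real (X \<inter> A) ((left_shift ^^ (p * m)) x) - indicat_real (X \<inter> A) x\<bar>)
          = (LINT x|\<nu>. indicat_real ?D x)"
        by (intro Bochner_Integration.integral_cong) (auto simp: space_nu X_shift indicator_def)
      also have "\<dots> = (LINT x|\<mu>. indicat_real ?D x)"
        using cyl_mu[OF D] by (intro integral_nu) simp
      also have "\<dots> = measure \<mu> ?D"
        by (simp add: space_mu)
      also have "\<dots> \<le> \<epsilon>"
      proof -
        obtain C where C: "\<And>N. (\<Sum>n<N. of_bool (((left_shift ^^ (n + p * m)) z \<in> A)
            \<noteq> ((left_shift ^^ n) z \<in> A))) \<le> \<epsilon> * real N + C"
          using per by blast
        have "(left_shift ^^ n) z \<in> ?D
            \<longleftrightarrow> ((left_shift ^^ (n + p * m)) z \<in> A) \<noteq> ((left_shift ^^ n) z \<in> A)" for n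
          by (simp add: add.commute[of n] funpow_add)
        then show ?thesis
          using C by (intro average_limit_le[OF frequency[OF mu D]]) simp
      qed
      finally show ?thesis .
    qed
    then show "\<exists>p\<ge>1. \<forall>m. (LINT x|\<nu>. \<bar>indicat_real (X \<inter> A) ((left_shift ^^ (p * m)) x)
        - indicat_real (X \<inter> A) x\<bar>) \<le> \<epsilon>"
      using p by blast
  qed (rule cyl_nu[OF A])
  then have ap: "\<forall>B\<in>sets \<nu>. almost_periodic_set B"
    using almost_periodic_set_sigma_sets[OF G] by blast

  have erg: "ergodic \<nu> left_shift"
  proof (rule ergodic_if_averages_converge[OF G])
    fix B and \<epsilon> :: real assume "B \<in> ?G" "\<epsilon> > 0"
    then obtain A where A: "A \<in> cylinders" and B: "B = X \<inter> A"
      by blast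
    let ?c = "measure \<mu> A"
    obtain K C where K: "K \<ge> 1" and C: "\<And>N. (\<Sum>n<N. \<bar>(\<Sum>m<K. of_bool ((left_shift ^^ (n + m)) z \<in> A)) / real K - ?c\<bar>)
        \<le> \<epsilon> * real N + C"
      by (rule mean_almost_periodic_uniform_averages[OF map_cyl[OF A] \<open>\<epsilon> > 0\<close> frequency[OF mu A]]) blast
    \<comment> \<open>The deviation of the average depends on finitely many coordinates, so its integral is its
      mean along the orbit of \<open>z\<close>.\<close>
    let ?h = "\<lambda>x. \<bar>(\<Sum>m<K. of_bool ((left_shift ^^ m) x \<in> A)) / real K - ?c\<bar>"
    have h: "finitely_determined ?h"
      using A unfolding cylinders_iff
      by (intro finitely_determined_comp[where h = "\<lambda>s. \<bar>s / real K - ?c\<bar>"] finitely_determined_sum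
          finitely_determined_comp[where h = of_bool] finitely_determined_shift) auto
    have c: "measure \<nu> B = ?c"
      using emeasure_nu[OF cyl_mu[OF A]] by (simp add: B Int_commute measure_def)
    have "(LINT x|\<nu>. \<bar>ergodic_average 1 B K x - measure \<nu> B\<bar>) = (LINT x|\<nu>. ?h x)"
      unfolding c
      by (intro Bochner_Integration.integral_cong refl)
        (auto simp: ergodic_average_def B space_nu X_shift indicator_def of_bool_def)
    also have "\<dots> = (LINT x|\<mu>. ?h x)"
      using finitely_determined_measurable[OF h, of borel]
      by (intro integral_nu) (simp add: measurable_cong_sets[OF sets_mu refl])
    also have "\<dots> \<le> \<epsilon>"
    proof (rule average_limit_le)
      show "(\<lambda>N. (\<Sum>n<N. ?h ((left_shift ^^ n) z)) / real N) \<longlonglongrightarrow> (LINT x|\<mu>. ?h x)"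
        using finitely_determined_average[OF mu h] by (simp only: divide_inverse scaleR_conv_of_real of_real_inverse of_real_of_nat_eq of_real_eq_id id_apply mult.commute)
      have "(left_shift ^^ m) ((left_shift ^^ n) z) = (left_shift ^^ (n + m)) z" for m n
        by (simp add: add.commute[of n] funpow_add)
      then show "(\<Sum>n<N. ?h ((left_shift ^^ n) z)) \<le> \<epsilon> * real N + C" for N
        using C[of N] by (simp only:)
    qed
    finally show "\<exists>N\<ge>1. (LINT x|\<nu>. \<bar>ergodic_average 1 B N x - measure \<nu> B\<bar>) \<le> \<epsilon>"
      using K by blast
  qed

  have distr_borel: "distr \<nu> borel (\<lambda>x. x) = \<mu>"
  proof (rule measure_eqI)
    fix A :: "(int \<Rightarrow> 'a) set" assume "A \<in> sets (distr \<nu> borel (\<lambda>x. x))"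
    then have A: "A \<in> sets borel" by simp
    have "(\<lambda>x. x) \<in> measurable \<nu> borel"
      unfolding measurable_cong_sets[OF sets_nu refl] by (rule measurable_restrict_space1) simp
    then show "emeasure (distr \<nu> borel (\<lambda>x. x)) A = emeasure \<mu> A"
      using A emeasure_nu[of A] by (simp add: emeasure_distr space_nu sets_mu)
  qed (simp add: sets_mu)
  have "generic_for \<eta> \<mu>"
    unfolding generic_for_def
  proof (intro allI impI)
    fix w :: "int \<Rightarrow> 'a" and f :: "(int \<Rightarrow> 'a) \<Rightarrow> complex"
    assume w: "\<forall>n\<ge>1. w (int n) = \<eta> n" and f: "continuous_on UNIV f"
    have "has_frequencies w \<mu>"
      by (rule has_frequencies_cong[OF freq]) (use w z in simp)
    then show "(\<lambda>N. (\<Sum>n<N. f ((left_shift ^^ n) w)) / of_nat N) \<longlonglongrightarrow> (LINT x|\<mu>. f x)"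
      by (rule continuous_average[OF _ prob sets_mu f])
  qed
  then show ?thesis
    using sets_nu prob_nu shift_nu distr_nu erg rational_discrete_spectrum_almost_periodic[OF ap]
    unfolding X_def[symmetric] invariant_measure_def distr_borel[symmetric] by blast
qed

end
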